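(* Any $p$-minimal surface of special type II is locally, up to a Heisenberg rigid motion, a part of the surface defined by the graph $u=xy+g(y)$ for some $g\in C^\infty(\mathbb{R})$. In addition, it is symmetric if and only if $g(y)$ is linear in the variable $y$ (i.e. $g'$ is constant). Therefore, any symmetric $p$-minimal surface of special type II is locally a part of the surface defined by the graph of $u=xy$, up to a Heisenberg rigid motion.
   Context: The Heisenberg group $H_1$ is $\mathbb{R}^3$ with the group law $(x_1,y_1,z_1)\circ(x_2,y_2,z_2)=(x_1+x_2,\,y_1+y_2,\,z_1+z_2+y_1x_2-x_1y_2)$. Left invariant fields: $\mathring e_1=\partial_x+y\partial_z$, $\mathring e_2=\partial_y-x\partial_z$, $T=\partial_z$. Contact form $\Theta=dz+x\,dy-y\,dx$, contact bundle $\xi=\ker\Theta$, $J\mathring e_1=\mathring e_2$, $J\mathring e_2=-\mathring e_1$. The adapted metric makes $\mathring e_1,\mathring e_2,T$ orthonormal; $\nabla$ is the connection for which they are parallel. A Heisenberg rigid motion is a diffeomorphism of $H_1$ preserving $(J,\Theta)$. All objects are $C^\infty$. The graph of a function $u(x,y)$ is $\{(x,y,u(x,y))\}\subset H_1$. For a surface $\Sigma\subset H_1$, a point is singular if $T_p\Sigma=\xi_p$, otherwise regular. On the regular part choose a unit field $e_1\in T\Sigma\cap\xi$ (up to sign), $e_2=Je_1$; $H$ is defined by $\nabla_{e_1}e_2=-He_1$; $p$-minimal means $H=0$ on the regular part. The $\alpha$-function is defined by $\alpha e_2+T\in T\Sigma$; $\hat e_1=e_1$, $\hat e_2=\frac{\alpha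 e_2+T}{\sqrt{1+\alpha^2}}$. Compatible coordinates: $e_1=\partial_x$, $\hat e_2=a\,\partial_x+b\,\partial_y$, $b>0$. A $p$-minimal surface without singular points is of special type II if, locally in compatible coordinates, $\alpha=\frac1{2x+c_1(y)}$. For such a surface there exist local normal coordinates, i.e. compatible coordinates in which $a=0$, $b=\frac{|\alpha|}{\sqrt{1+\alpha^2}}$, $\alpha=\frac{1}{2x+\zeta_1(y)}$; the function $\zeta_1$ (the $\zeta_1$-invariant) is determined up to translation in $y$ and addition of a constant. The surface is called symmetric if its $\zeta_1$-invariant is constant. *)

theory Defs
  imports "HOL-Analysis.Analysis"
begin

section \<open>Smooth maps\<close>

text \<open>
  Being \<open>C\<^sup>k\<close>, and \<open>C\<^sup>\<infinity>\<close>, on an open set: continuity of all iterated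
  directional derivatives, each of which is itself Frechet differentiable up to the required order.
\<close>

fun Ck_on :: "nat \<Rightarrow> 'a::real_normed_vector set \<Rightarrow> ('a \<Rightarrow> 'b::real_normed_vector) \<Rightarrow> bool" where
  "Ck_on 0 S f \<longleftrightarrow> continuous_on S f"
| "Ck_on (Suc k) S f \<longleftrightarrow>
     (\<forall>x\<in>S. f differentiable (at x)) \<and> (\<forall>v. Ck_on k S (\<lambda>x. frechet_derivative f (at x) v))"

definition smooth_on :: "'a::real_normed_vector set \<Rightarrow> ('a \<Rightarrow> 'b::real_normed_vector) \<Rightarrow> bool" where
  "smooth_on S f \<longleftrightarrow> (\<forall>k. Ck_on k S f)"

section \<open>The Heisenberg group\<close>

text \<open>
  Points and tangent vectors of \<open>H\<^sub>1\<close> are both triples: the vector \<open>(a, b, c)\<close> stands for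
  \<open>a \<partial>\<^sub>x + b \<partial>\<^sub>y + c \<partial>\<^sub>z\<close>. The fields below are left invariant for the law
  \<open>(x\<^sub>1, y\<^sub>1, z\<^sub>1) (x\<^sub>2, y\<^sub>2, z\<^sub>2) = (x\<^sub>1 + x\<^sub>2, y\<^sub>1 + y\<^sub>2, z\<^sub>1 + z\<^sub>2 + y\<^sub>1 x\<^sub>2 - x\<^sub>1 y\<^sub>2)\<close>.
\<close>

type_synonym heis = "real \<times> real \<times> real"

definition frame1 :: "heis \<Rightarrow> heis" where
  "frame1 = (\<lambda>(x, y, z). (1, 0, y))"

definition frame2 :: "heis \<Rightarrow> heis" where
  "frame2 = (\<lambda>(x, y, z). (0, 1, - x))"

definition reeb :: "heis \<Rightarrow> heis" where
  "reeb p = (0, 0, 1)"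

definition contact_form :: "heis \<Rightarrow> heis \<Rightarrow> real" where
  "contact_form = (\<lambda>(x, y, z) (a, b, c). c + x * b - y * a)"

definition contact_plane :: "heis \<Rightarrow> heis set" where
  "contact_plane p = {v. contact_form p v = 0}"

text \<open>
  The coframe \<open>(dx, dy, \<Theta>)\<close> is dual to the left invariant frame; \<open>coframe p v\<close> lists the
  coefficients of \<open>v\<close> with respect to that frame, and \<open>of_coframe p\<close> is the inverse map.
\<close>

definition coframe :: "heis \<Rightarrow> heis \<Rightarrow> heis" where
  "coframe p v = (fst v, fst (snd v), contact_form p v)"

definition of_coframe :: "heis \<Rightarrow> heis \<Rightarrow> heis" where
  "of_coframe p = (\<lambda>(a, b, c). a *\<^sub>R frame1 p + b *\<^sub>R frame2 p + c *\<^sub>R reeb p)"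

text \<open>
  The map \<open>J\<close> only matters on the contact planes; it is totalised by sending the Reeb field to \<open>0\<close>.
\<close>

definition cplx :: "heis \<Rightarrow> heis \<Rightarrow> heis" where
  "cplx p v = (case coframe p v of (a, b, c) \<Rightarrow> a *\<^sub>R frame2 p - b *\<^sub>R frame1 p)"

definition adapted_metric :: "heis \<Rightarrow> heis \<Rightarrow> heis \<Rightarrow> real" where
  "adapted_metric p v w = coframe p v \<bullet> coframe p w"

definition rigid_motion :: "(heis \<Rightarrow> heis) \<Rightarrow> bool" where
  "rigid_motion \<phi> \<longleftrightarrow>
     bij \<phi> \<and> smooth_on UNIV \<phi> \<and> smooth_on UNIV (inv \<phi>) \<and>
     (\<forall>p v. contact_form (\<phi> p) (frechet_derivative \<phi> (at p) v) = contact_form p v) \<and>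
     (\<forall>p. \<forall>v\<in>contact_plane p.
        cplx (\<phi> p) (frechet_derivative \<phi> (at p) v) = frechet_derivative \<phi> (at p) (cplx p v))"

section \<open>Surfaces\<close>

text \<open>
  Local parametrisations of a set \<open>\<Sigma>\<close> as an embedded surface; their inverses are the local
  coordinate systems \<open>(x, y)\<close> on \<open>\<Sigma>\<close>.
\<close>

definition surface_chart :: "heis set \<Rightarrow> (real \<times> real) set \<Rightarrow> (real \<times> real \<Rightarrow> heis) \<Rightarrow> bool" where
  "surface_chart \<Sigma> V X \<longleftrightarrow>
     open V \<and> smooth_on V X \<and> (\<forall>q\<in>V. inj (frechet_derivative X (at q))) \<and>
     openin (top_of_set \<Sigma>) (X ` V) \<and> (\<exists>Y. homeomorphism V (X ` V) X Y)"

definition embedded_surface :: "heis set \<Rightarrow> bool" where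
  "embedded_surface \<Sigma> \<longleftrightarrow> (\<forall>p\<in>\<Sigma>. \<exists>V X. surface_chart \<Sigma> V X \<and> p \<in> X ` V)"

text \<open>
  The tangent plane at the point \<open>X q\<close>; by the chain rule it does not depend on the chart.
\<close>

definition tangent_plane :: "(real \<times> real \<Rightarrow> heis) \<Rightarrow> real \<times> real \<Rightarrow> heis set" where
  "tangent_plane X q = range (frechet_derivative X (at q))"

definition singular_at :: "(real \<times> real \<Rightarrow> heis) \<Rightarrow> real \<times> real \<Rightarrow> bool" where
  "singular_at X q \<longleftrightarrow> tangent_plane X q = contact_plane (X q)"

definition no_singular_points :: "heis set \<Rightarrow> bool" where
  "no_singular_points \<Sigma> \<longleftrightarrow> (\<forall>V X. surface_chart \<Sigma> V X \<longrightarrow> (\<forall>q\<in>V. \<not> singular_at X q))"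

text \<open>
  A choice of the field \<open>e\<^sub>1\<close> over a chart of the regular part. Vector fields along a surface are
  written as functions of the chart parameter.
\<close>

definition characteristic_field ::
    "(real \<times> real) set \<Rightarrow> (real \<times> real \<Rightarrow> heis) \<Rightarrow> (real \<times> real \<Rightarrow> heis) \<Rightarrow> bool" where
  "characteristic_field V X E \<longleftrightarrow>
     smooth_on V E \<and>
     (\<forall>q\<in>V. \<not> singular_at X q \<and> E q \<in> tangent_plane X q \<inter> contact_plane (X q) \<and>
             adapted_metric (X q) (E q) (E q) = 1)"

text \<open>
  The covariant derivative, at \<open>q\<close>, of the field \<open>W\<close> along \<open>X\<close> in the direction of the tangent
  field \<open>E\<close>. The left invariant frame being parallel, only the coefficients of \<open>W\<close> get
  differentiated, in the parameter direction that \<open>dX\<close> maps to \<open>E q\<close>.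
\<close>

definition nabla ::
    "(real \<times> real \<Rightarrow> heis) \<Rightarrow> (real \<times> real \<Rightarrow> heis) \<Rightarrow> (real \<times> real \<Rightarrow> heis) \<Rightarrow> real \<times> real \<Rightarrow> heis" where
  "nabla X E W q =
     of_coframe (X q)
       (frechet_derivative (\<lambda>r. coframe (X r) (W r)) (at q)
         (THE w. frechet_derivative X (at q) w = E q))"

definition p_mean_curvature ::
    "(real \<times> real \<Rightarrow> heis) \<Rightarrow> (real \<times> real \<Rightarrow> heis) \<Rightarrow> real \<times> real \<Rightarrow> real" where
  "p_mean_curvature X E q = (THE H. nabla X E (\<lambda>r. cplx (X r) (E r)) q = - (H *\<^sub>R E q))"

text \<open>
  Restricting a chart to a smaller open set gives a chart, so the quantification below covers the
  whole regular part; the vanishing of \<open>H\<close> does not depend on the sign of \<open>e\<^sub>1\<close>.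
\<close>

definition p_minimal :: "heis set \<Rightarrow> bool" where
  "p_minimal \<Sigma> \<longleftrightarrow>
     embedded_surface \<Sigma> \<and>
     (\<forall>V X E. surface_chart \<Sigma> V X \<longrightarrow> characteristic_field V X E \<longrightarrow>
        (\<forall>q\<in>V. p_mean_curvature X E q = 0))"

definition alpha ::
    "(real \<times> real \<Rightarrow> heis) \<Rightarrow> (real \<times> real \<Rightarrow> heis) \<Rightarrow> real \<times> real \<Rightarrow> real" where
  "alpha X E q = (THE a. a *\<^sub>R cplx (X q) (E q) + reeb (X q) \<in> tangent_plane X q)"

definition e2_hat ::
    "(real \<times> real \<Rightarrow> heis) \<Rightarrow> (real \<times> real \<Rightarrow> heis) \<Rightarrow> real \<times> real \<Rightarrow> heis" where
  "e2_hat X E q =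
     (1 / sqrt (1 + (alpha X E q)\<^sup>2)) *\<^sub>R (alpha X E q *\<^sub>R cplx (X q) (E q) + reeb (X q))"

section \<open>Compatible and normal coordinates\<close>

definition partial_x :: "(real \<times> real \<Rightarrow> heis) \<Rightarrow> real \<times> real \<Rightarrow> heis" where
  "partial_x X q = frechet_derivative X (at q) (1, 0)"

definition partial_y :: "(real \<times> real \<Rightarrow> heis) \<Rightarrow> real \<times> real \<Rightarrow> heis" where
  "partial_y X q = frechet_derivative X (at q) (0, 1)"

text \<open>
  Compatible coordinates single out the sign of \<open>e\<^sub>1\<close>, namely \<open>e\<^sub>1 = \<partial>\<^sub>x\<close>, and thereby that of
  \<open>\<alpha>\<close>.
\<close>

definition compatible_chart ::
    "heis set \<Rightarrow> (real \<times> real) set \<Rightarrow> (real \<times> real \<Rightarrow> heis) \<Rightarrow>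
     (real \<times> real \<Rightarrow> real) \<Rightarrow> (real \<times> real \<Rightarrow> real) \<Rightarrow> bool" where
  "compatible_chart \<Sigma> V X a b \<longleftrightarrow>
     surface_chart \<Sigma> V X \<and> characteristic_field V X (partial_x X) \<and>
     (\<forall>q\<in>V. b q > 0 \<and>
        e2_hat X (partial_x X) q = a q *\<^sub>R partial_x X q + b q *\<^sub>R partial_y X q)"

text \<open>
  The equation \<open>\<alpha> = 1 / (2 x + c(y))\<close>, with the denominator required not to vanish.
\<close>

definition alpha_type_II ::
    "(real \<times> real) set \<Rightarrow> (real \<times> real \<Rightarrow> heis) \<Rightarrow> (real \<Rightarrow> real) \<Rightarrow> bool" where
  "alpha_type_II V X c \<longleftrightarrow>
     smooth_on (snd ` V) c \<and>
     (\<forall>(x, y)\<in>V. 2 * x + c y \<noteq> 0 \<and> alpha X (partial_x X) (x, y) = 1 / (2 * x + c y))"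

definition special_type_II :: "heis set \<Rightarrow> bool" where
  "special_type_II \<Sigma> \<longleftrightarrow>
     p_minimal \<Sigma> \<and> no_singular_points \<Sigma> \<and>
     (\<forall>p\<in>\<Sigma>. \<exists>V X a b c. compatible_chart \<Sigma> V X a b \<and> p \<in> X ` V \<and> alpha_type_II V X c)"

definition normal_chart ::
    "heis set \<Rightarrow> (real \<times> real) set \<Rightarrow> (real \<times> real \<Rightarrow> heis) \<Rightarrow> (real \<Rightarrow> real) \<Rightarrow> bool" where
  "normal_chart \<Sigma> V X \<zeta> \<longleftrightarrow>
     compatible_chart \<Sigma> V X (\<lambda>q. 0)
       (\<lambda>q. \<bar>alpha X (partial_x X) q\<bar> / sqrt (1 + (alpha X (partial_x X) q)\<^sup>2)) \<and>
     alpha_type_II V X \<zeta>"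

text \<open>
  The \<open>\<zeta>\<^sub>1\<close>-invariant is a local object, read off in normal coordinates near each point.
  Since it is unique up to translation in \<open>y\<close> and an additive constant, constancy does not depend
  on the normal coordinates used.
\<close>

definition symmetric_type_II :: "heis set \<Rightarrow> bool" where
  "symmetric_type_II \<Sigma> \<longleftrightarrow>
     special_type_II \<Sigma> \<and>
     (\<forall>p\<in>\<Sigma>. \<exists>V X \<zeta>. normal_chart \<Sigma> V X \<zeta> \<and> p \<in> X ` V \<and> \<zeta> constant_on (snd ` V))"

definition graph :: "(real \<Rightarrow> real \<Rightarrow> real) \<Rightarrow> heis set" where
  "graph u = {(x, y, u x y) |x y. True}"

end

theory Submission
  imports Defs
begin

text \<open>
  In compatible coordinates put \<open>\<beta>\<close> and \<open>\<tau>\<close> for the components of \<open>\<partial>\<^sub>y\<close> along \<open>e\<^sub>2\<close> and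
  \<open>T\<close>, so that \<open>\<alpha> = \<beta> / \<tau>\<close>. Since \<open>\<partial>\<^sub>x = e\<^sub>1\<close> is horizontal and constant in the left invariant
  frame along the characteristics, \<open>\<partial>\<^sub>x \<tau> = 2 \<beta>\<close>. Differentiating \<open>\<beta> (2 x + c(y)) = \<tau>\<close> in \<open>x\<close>
  gives \<open>\<partial>\<^sub>x \<beta> = 0\<close>, which says that the characteristic lines do not turn. After a rotation they are
  parallel to the first frame field, and then \<open>z - x y\<close> and \<open>y\<close> only depend on the second coordinate:
  the surface is a piece of a graph \<open>z = x y + g(y)\<close>. On such a graph \<open>1 / \<alpha> = \<plusminus> (2 x + g'(y))\<close>, so
  \<open>\<zeta>\<^sub>1\<close> is \<open>g'\<close> up to sign and additive constants. For \<open>g(y) = k y + d\<close> the left translation by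
  \<open>(k / 2, 0, - d)\<close> carries the graph to \<open>z = x y\<close>. A rigid motion enters only through its
  differential, which rotates the horizontal frame and fixes \<open>T\<close>.
\<close>

section \<open>Calculus of smooth maps\<close>

text \<open>Two gaps lie between the local computation and the statement. The surface determines g
  only on the range of its y-coordinate, while g has to be smooth, and in the symmetric case to have
  constant derivative, on the whole line; hence the extension of germs by a cutoff, and the affine
  replacement of g on symmetric pieces. Moreover the \<zeta>-invariant is read off chart by chart,
  with signs and additive constants that may change; connectedness of the piece joins the local
  constants into one. Type II enters twice. The slope 2 of 1 / \<alpha> in x is what makes the terms
  2 \<beta> cancel, and \<alpha> \<noteq> 0 makes the rotated y-coordinate an injective function of
  the second parameter, so that z - x y becomes a smooth function of it. Symmetry of second
  derivatives serves both the mixed partials of a chart and the fact that a rigid motion preserves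
  the differential of the contact form.\<close>

lemma Ck_on_cong:
  assumes "open S" "\<And>x. x \<in> S \<Longrightarrow> f x = g x" "Ck_on k S f"
  shows "Ck_on k S g"
  using assms(2,3)
proof (induction k arbitrary: f g)
  case 0
  then show ?case by (simp cong: continuous_on_cong)
next
  case (Suc k)
  have "g differentiable (at x)" if "x \<in> S" for x
    using Suc.prems that assms(1) has_derivative_transform_within_open[of f _ x UNIV S g]
    by (simp add: differentiable_def) blast
  moreover have "Ck_on k S (\<lambda>x. frechet_derivative g (at x) v)" for v
  proof (rule Suc.IH)
    show "Ck_on k S (\<lambda>x. frechet_derivative f (at x) v)" using Suc.prems(2) by simp
    show "frechet_derivative f (at x) v = frechet_derivative g (at x) v" if "x \<in> S" for x
      using frechet_derivative_transform_within_open[of f x S g] Suc.prems that assms(1) by simp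
  qed
  ultimately show ?case by simp
qed

lemma Ck_on_SucI:
  assumes "open S" "\<And>x. x \<in> S \<Longrightarrow> (f has_derivative D x) (at x)"
    and "\<And>v. Ck_on k S (\<lambda>x. D x v)"
  shows "Ck_on (Suc k) S f"
proof -
  have "D x v = frechet_derivative f (at x) v" if "x \<in> S" for x v
    using frechet_derivative_at[OF assms(2)[OF that]] by simp
  then show ?thesis
    using assms(2) Ck_on_cong[OF assms(1) _ assms(3)] by (auto simp: differentiable_def)
qed

lemma Ck_on_SucD1: "Ck_on (Suc k) S f \<Longrightarrow> x \<in> S \<Longrightarrow> (f has_derivative frechet_derivative f (at x)) (at x)"
  using frechet_derivative_works by auto

lemma Ck_on_Suc_imp: "Ck_on (Suc k) S f \<Longrightarrow> Ck_on k S f"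
proof (induction k arbitrary: f)
  case 0
  then show ?case
    by (auto intro!: differentiable_imp_continuous_on simp: differentiable_on_def
        differentiable_at_withinI)
next
  case (Suc k)
  then show ?case by (metis Ck_on.simps(2))
qed

lemma Ck_on_subset: "Ck_on k S f \<Longrightarrow> T \<subseteq> S \<Longrightarrow> Ck_on k T f"
  by (induction k arbitrary: f) (auto intro: continuous_on_subset)

lemma Ck_on_Un: "open S \<Longrightarrow> open T \<Longrightarrow> Ck_on k S f \<Longrightarrow> Ck_on k T f \<Longrightarrow> Ck_on k (S \<union> T) f"
  by (induction k arbitrary: f) (auto intro: continuous_on_open_Un)

lemma Ck_on_const: "Ck_on k S (\<lambda>x. c)"
  by (induction k arbitrary: c) auto

lemma Ck_on_add:
  assumes "open S" "Ck_on k S f" "Ck_on k S g"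
  shows "Ck_on k S (\<lambda>x. f x + g x)"
  using assms(2,3)
proof (induction k arbitrary: f g)
  case 0
  then show ?case by (simp add: continuous_on_add)
next
  case (Suc k)
  show ?case
    by (rule Ck_on_SucI[OF assms(1) has_derivative_add])
      (use Suc Ck_on_SucD1[OF Suc.prems(1)] Ck_on_SucD1[OF Suc.prems(2)] in auto)
qed

lemma Ck_on_linear:
  assumes "open S" "bounded_linear L" "Ck_on k S f"
  shows "Ck_on k S (\<lambda>x. L (f x))"
  using assms(3)
proof (induction k arbitrary: f)
  case 0
  then show ?case using bounded_linear.continuous_on[OF assms(2)] by simp
next
  case (Suc k)
  show ?case
    by (rule Ck_on_SucI[OF assms(1) bounded_linear.has_derivative[OF assms(2)]])
      (use Suc Ck_on_SucD1[OF Suc.prems] in auto)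
qed

lemma Ck_on_sum:
  assumes "open S" "\<And>i. i \<in> I \<Longrightarrow> Ck_on k S (f i)"
  shows "Ck_on k S (\<lambda>x. \<Sum>i\<in>I. f i x)"
proof (cases "finite I")
  case True
  then show ?thesis
    using assms(2) by (induction I) (auto intro: Ck_on_const Ck_on_add assms(1))
qed (simp add: Ck_on_const)

lemma Ck_on_bilinear:
  assumes "open S" "bounded_bilinear B" "Ck_on k S f" "Ck_on k S g"
  shows "Ck_on k S (\<lambda>x. B (f x) (g x))"
  using assms(3,4)
proof (induction k arbitrary: f g)
  case 0
  then show ?case using bounded_bilinear.continuous_on[OF assms(2)] by simp
next
  case (Suc k)
  show ?case
    by (rule Ck_on_SucI[OF assms(1) bounded_bilinear.FDERIV[OF assms(2)
          Ck_on_SucD1[OF Suc.prems(1)] Ck_on_SucD1[OF Suc.prems(2)]]])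
      (use Suc in \<open>auto intro!: Ck_on_add[OF assms(1)] Suc.IH dest: Ck_on_Suc_imp
           simp del: Ck_on.simps(2) elim: Ck_on.simps(2)[THEN iffD1, THEN conjunct2, rule_format]\<close>)
qed

lemma Ck_on_bounded_linear: "open S \<Longrightarrow> bounded_linear f \<Longrightarrow> Ck_on k S f"
  by (cases k) (auto simp: linear_continuous_on
      intro!: Ck_on_SucI[OF _ bounded_linear.has_derivative[OF _ has_derivative_ident]] Ck_on_const
      simp del: Ck_on.simps(2))

text \<open>\<open>Ck_on\<close> speaks of derivatives in fixed directions only, whereas the chain
  rule applies the derivative of f to a direction that moves with x. Expanding it in
  \<open>Basis\<close> leaves a finite sum of scalar functions times derivatives of f in fixed
  directions, which the induction hypothesis covers; this is why the middle space is
  Euclidean.\<close>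

lemma Ck_on_compose:
  fixes f :: "'b::euclidean_space \<Rightarrow> 'c::real_normed_vector"
  assumes "open S" "open T" "g ` S \<subseteq> T" "Ck_on k T f" "Ck_on k S g"
  shows "Ck_on k S (\<lambda>x. f (g x))"
  using assms(4,5)
proof (induction k arbitrary: f)
  case 0
  then show ?case using assms(3) continuous_on_compose2 by (auto intro: continuous_on_compose2)
next
  case (Suc k)
  define D where "D x v = (\<Sum>b\<in>Basis. (frechet_derivative g (at x) v \<bullet> b) *\<^sub>R
      frechet_derivative f (at (g x)) b)" for x v
  show ?case
  proof (rule Ck_on_SucI[OF assms(1)])
    fix x assume x: "x \<in> S"
    have f: "(f has_derivative frechet_derivative f (at (g x))) (at (g x))"
      using Ck_on_SucD1[OF Suc.prems(1)] x assms(3) by auto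
    have "frechet_derivative f (at (g x)) (frechet_derivative g (at x) v) = D x v" for v
    proof -
      interpret linear "frechet_derivative f (at (g x))"
        using f has_derivative_linear by blast
      show ?thesis
        unfolding D_def
        by (subst euclidean_representation[of "frechet_derivative g (at x) v", symmetric],
            subst sum, simp add: scale)
    qed
    then show "((\<lambda>x. f (g x)) has_derivative D x) (at x)"
      using has_derivative_compose[OF Ck_on_SucD1[OF Suc.prems(2) x] f] by (simp add: fun_eq_iff[symmetric])
  next
    fix v
    have g: "Ck_on k S g" using Suc.prems(2) by (rule Ck_on_Suc_imp)
    have "Ck_on k S (\<lambda>x. frechet_derivative g (at x) v \<bullet> b)" for b
      using Suc.prems(2) by (intro Ck_on_linear[OF assms(1) bounded_linear_inner_left]) auto
    moreover have "Ck_on k S (\<lambda>x. frechet_derivative f (at (g x)) b)" for b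
      using Suc.IH[OF _ g, of "\<lambda>y. frechet_derivative f (at y) b"] Suc.prems(1) by simp
    ultimately show "Ck_on k S (\<lambda>x. D x v)"
      unfolding D_def
      by (intro Ck_on_sum Ck_on_bilinear[OF assms(1) bounded_bilinear_scaleR]) (auto intro: assms(1))
  qed
qed

text \<open>The derivative is a polynomial in \<open>inverse\<close> itself, so each order reduces
  to the previous one.\<close>

lemma Ck_on_inverse: "Ck_on k (- {0}) (inverse :: real \<Rightarrow> real)"
proof (induction k)
  case 0
  then show ?case by (auto intro: continuous_on_inverse continuous_on_id)
next
  case (Suc k)
  show ?case
  proof (rule Ck_on_SucI)
    show "(inverse has_derivative (\<lambda>h. - (inverse x * h * inverse x))) (at x)"
      if "x \<in> - {0::real}" for x
      using has_derivative_inverse'[of x] that by simp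
    show "Ck_on k (- {0}) (\<lambda>x::real. - (inverse x * v * inverse x))" for v
      by (intro Ck_on_linear[OF _ bounded_linear_minus[OF bounded_linear_ident]]
          Ck_on_bilinear[OF _ bounded_bilinear_mult] Suc Ck_on_const open_Compl) auto
  qed auto
qed

section \<open>Closure rules for smooth maps\<close>

lemma smooth_on_cong:
  "open S \<Longrightarrow> (\<And>x. x \<in> S \<Longrightarrow> f x = g x) \<Longrightarrow> smooth_on S f \<Longrightarrow> smooth_on S g"
  unfolding smooth_on_def using Ck_on_cong by blast

lemma smooth_on_subset: "smooth_on S f \<Longrightarrow> T \<subseteq> S \<Longrightarrow> smooth_on T f"
  unfolding smooth_on_def using Ck_on_subset by blast

lemma smooth_on_Un: "open S \<Longrightarrow> open T \<Longrightarrow> smooth_on S f \<Longrightarrow> smooth_on T f \<Longrightarrow> smooth_on (S \<union> T) f"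
  unfolding smooth_on_def using Ck_on_Un by blast

lemma smooth_on_const: "smooth_on S (\<lambda>x. c)"
  unfolding smooth_on_def using Ck_on_const by blast

lemma smooth_on_bounded_linear: "open S \<Longrightarrow> bounded_linear f \<Longrightarrow> smooth_on S f"
  unfolding smooth_on_def using Ck_on_bounded_linear by blast

lemma smooth_on_linear:
  "open S \<Longrightarrow> bounded_linear L \<Longrightarrow> smooth_on S f \<Longrightarrow> smooth_on S (\<lambda>x. L (f x))"
  unfolding smooth_on_def using Ck_on_linear by blast

lemma smooth_on_add: "open S \<Longrightarrow> smooth_on S f \<Longrightarrow> smooth_on S g \<Longrightarrow> smooth_on S (\<lambda>x. f x + g x)"
  unfolding smooth_on_def using Ck_on_add by blast

lemma smooth_on_minus: "open S \<Longrightarrow> smooth_on S f \<Longrightarrow> smooth_on S (\<lambda>x. - f x)"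
  by (rule smooth_on_linear[OF _ bounded_linear_minus[OF bounded_linear_ident]])

lemma smooth_on_diff: "open S \<Longrightarrow> smooth_on S f \<Longrightarrow> smooth_on S g \<Longrightarrow> smooth_on S (\<lambda>x. f x - g x)"
  using smooth_on_add[of S f "\<lambda>x. - g x"] smooth_on_minus[of S g] by simp

lemma smooth_on_mult:
  fixes f g :: "'a::real_normed_vector \<Rightarrow> real"
  shows "open S \<Longrightarrow> smooth_on S f \<Longrightarrow> smooth_on S g \<Longrightarrow> smooth_on S (\<lambda>x. f x * g x)"
  unfolding smooth_on_def using Ck_on_bilinear[OF _ bounded_bilinear_mult] by blast

lemma smooth_on_compose:
  fixes f :: "'b::euclidean_space \<Rightarrow> 'c::real_normed_vector"
  shows "open S \<Longrightarrow> open T \<Longrightarrow> g ` S \<subseteq> T \<Longrightarrow> smooth_on T f \<Longrightarrow> smooth_on S g \<Longrightarrow>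
    smooth_on S (\<lambda>x. f (g x))"
  unfolding smooth_on_def using Ck_on_compose by blast

lemma smooth_on_divide:
  fixes f g :: "'a::real_normed_vector \<Rightarrow> real"
  assumes "open S" "smooth_on S f" "smooth_on S g" "\<And>x. x \<in> S \<Longrightarrow> g x \<noteq> 0"
  shows "smooth_on S (\<lambda>x. f x / g x)"
proof -
  have "smooth_on (- {0}) (inverse :: real \<Rightarrow> real)"
    using Ck_on_inverse by (simp add: smooth_on_def)
  then have "smooth_on S (\<lambda>x. inverse (g x))"
    by (rule smooth_on_compose[rotated 3]) (use assms in auto)
  then show ?thesis
    using smooth_on_mult[OF assms(1,2)] by (simp add: divide_inverse)
qed

lemma smooth_on_Pair:
  assumes "open S" "smooth_on S f" "smooth_on S g"
  shows "smooth_on S (\<lambda>x. (f x, g x))"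
proof -
  have 1: "bounded_linear (\<lambda>u::'b. (u, 0::'c))" and 2: "bounded_linear (\<lambda>u::'c. (0::'b, u))"
    by (intro bounded_linear_Pair bounded_linear_ident bounded_linear_zero)+
  show ?thesis
    using smooth_on_add[OF assms(1) smooth_on_linear[OF assms(1) 1 assms(2)]
        smooth_on_linear[OF assms(1) 2 assms(3)]] by simp
qed

lemma smooth_on_fst: "open S \<Longrightarrow> smooth_on S f \<Longrightarrow> smooth_on S (\<lambda>x. fst (f x))"
  by (rule smooth_on_linear[OF _ bounded_linear_fst])

lemma smooth_on_snd: "open S \<Longrightarrow> smooth_on S f \<Longrightarrow> smooth_on S (\<lambda>x. snd (f x))"
  by (rule smooth_on_linear[OF _ bounded_linear_snd])

lemma smooth_on_ident: "open S \<Longrightarrow> smooth_on S (\<lambda>x. x)"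
  by (rule smooth_on_bounded_linear[OF _ bounded_linear_ident])

lemmas smooth_on_intros =
  smooth_on_const smooth_on_ident smooth_on_add smooth_on_minus smooth_on_diff smooth_on_mult
  smooth_on_Pair smooth_on_fst smooth_on_snd

section \<open>Derivatives of smooth maps\<close>

lemma smooth_on_has_derivative:
  "smooth_on S f \<Longrightarrow> x \<in> S \<Longrightarrow> (f has_derivative frechet_derivative f (at x)) (at x)"
  unfolding smooth_on_def using Ck_on_SucD1 by blast

lemma smooth_on_frechet_derivative:
  "smooth_on S f \<Longrightarrow> smooth_on S (\<lambda>x. frechet_derivative f (at x) v)"
  unfolding smooth_on_def by (metis Ck_on.simps(2))

lemma smooth_on_continuous_on: "smooth_on S f \<Longrightarrow> continuous_on S f"
  unfolding smooth_on_def by (metis Ck_on.simps(1))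

lemma smooth_on_DERIV:
  fixes f :: "real \<Rightarrow> real"
  assumes "smooth_on S f" "x \<in> S"
  shows "(f has_field_derivative deriv f x) (at x)"
  using smooth_on_has_derivative[OF assms]
  by (metis DERIV_deriv_iff_real_differentiable differentiable_def)

lemma frechet_derivative_real:
  fixes f :: "real \<Rightarrow> real"
  assumes "(f has_field_derivative d) (at x)"
  shows "frechet_derivative f (at x) v = d * v"
  using frechet_derivative_at[of f "(*) d" x] assms by (simp add: has_field_derivative_def)

lemma smooth_on_deriv:
  fixes f :: "real \<Rightarrow> real"
  assumes "open S" "smooth_on S f"
  shows "smooth_on S (deriv f)"
  by (rule smooth_on_cong[OF assms(1) _ smooth_on_frechet_derivative[OF assms(2), of 1]])
    (simp add: frechet_derivative_real[OF smooth_on_DERIV[OF assms(2)]])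

section \<open>Symmetry of the second derivative\<close>

text \<open>The mean value theorem is applied along v to the increment of f in the direction w, then
  along w to the derivative in the direction v. The left side is symmetric in v and w, the right
  side is not; comparing both orders proves the symmetry of second derivatives.\<close>

lemma second_difference_mean_value:
  fixes f :: "'a::real_normed_vector \<Rightarrow> real"
  assumes h: "h > 0"
    and in_S: "\<And>s t. 0 \<le> s \<Longrightarrow> s \<le> h \<Longrightarrow> 0 \<le> t \<Longrightarrow> t \<le> h \<Longrightarrow> x + s *\<^sub>R v + t *\<^sub>R w \<in> S"
    and f: "smooth_on S f"
  shows "\<exists>s t. 0 < s \<and> s < h \<and> 0 < t \<and> t < h \<and>
    f (x + h *\<^sub>R v + h *\<^sub>R w) - f (x + h *\<^sub>R v) - f (x + h *\<^sub>R w) + f x =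
    h\<^sup>2 * frechet_derivative (\<lambda>y. frechet_derivative f (at y) v) (at (x + s *\<^sub>R v + t *\<^sub>R w)) w"
proof -
  have fd: "((\<lambda>s. F (y + s *\<^sub>R u)) has_field_derivative frechet_derivative F (at (y + s *\<^sub>R u)) u) (at s)"
    if "smooth_on S F" "y + s *\<^sub>R u \<in> S" for F :: "'a \<Rightarrow> real" and y s u
  proof -
    have 1: "((\<lambda>s. y + s *\<^sub>R u) has_derivative (\<lambda>r. r *\<^sub>R u)) (at s)"
      by (auto intro!: derivative_eq_intros)
    note 2 = smooth_on_has_derivative[OF that]
    from has_derivative_compose[OF 1 2] has_derivative_linear[OF 2] show ?thesis
      by (simp add: has_field_derivative_def linear_scale mult.commute[of _ "frechet_derivative F _ _"] fun_eq_iff cong: if_cong)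
  qed
  define G where "G s = f (x + h *\<^sub>R w + s *\<^sub>R v) - f (x + s *\<^sub>R v)" for s
  define g where "g s = frechet_derivative f (at (x + h *\<^sub>R w + s *\<^sub>R v)) v -
    frechet_derivative f (at (x + s *\<^sub>R v)) v" for s
  have "(G has_field_derivative g s) (at s)" if "0 \<le> s" "s \<le> h" for s
    unfolding G_def g_def
    by (intro DERIV_diff fd f) (use in_S[of s h] in_S[of s 0] h that in \<open>auto simp: algebra_simps\<close>)
  then obtain s where s: "0 < s" "s < h" "G h - G 0 = h * g s"
    using MVT2[of 0 h G g] h by auto
  define K where "K t = frechet_derivative f (at (x + s *\<^sub>R v + t *\<^sub>R w)) v" for t
  have "(K has_field_derivative frechet_derivative (\<lambda>y. frechet_derivative f (at y) v)
      (at (x + s *\<^sub>R v + t *\<^sub>R w)) w) (at t)" if "0 \<le> t" "t \<le> h" for t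
    unfolding K_def
    by (intro fd smooth_on_frechet_derivative f in_S) (use s that in auto)
  then obtain t where t: "0 < t" "t < h" "K h - K 0 = h * frechet_derivative
      (\<lambda>y. frechet_derivative f (at y) v) (at (x + s *\<^sub>R v + t *\<^sub>R w)) w"
    using MVT2[of 0 h K] h by fastforce
  have "g s = K h - K 0"
    by (simp add: g_def K_def algebra_simps)
  then have "G h - G 0 = h\<^sup>2 * frechet_derivative
      (\<lambda>y. frechet_derivative f (at y) v) (at (x + s *\<^sub>R v + t *\<^sub>R w)) w"
    using s(3) t(3) by (simp add: power2_eq_square)
  moreover have "G h - G 0 =
    f (x + h *\<^sub>R v + h *\<^sub>R w) - f (x + h *\<^sub>R v) - f (x + h *\<^sub>R w) + f x"
    by (simp add: G_def algebra_simps)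
  ultimately show ?thesis using s t by metis
qed

lemma symmetric_second_frechet_derivative:
  fixes f :: "'a::real_normed_vector \<Rightarrow> real"
  assumes "open S" "smooth_on S f" "x \<in> S"
  shows "frechet_derivative (\<lambda>y. frechet_derivative f (at y) v) (at x) w =
    frechet_derivative (\<lambda>y. frechet_derivative f (at y) w) (at x) v" (is "?A x = ?B x")
proof (rule ccontr)
  assume "?A x \<noteq> ?B x"
  then have e: "\<bar>?A x - ?B x\<bar> / 2 > 0" (is "?e > 0") by simp
  have "continuous_on S ?A" "continuous_on S ?B"
    by (intro smooth_on_continuous_on smooth_on_frechet_derivative assms)+
  then have "isCont ?A x" "isCont ?B x"
    using assms(1,3) continuous_on_eq_continuous_at by blast+
  then obtain d1 d2 where d: "d1 > 0" "\<And>y. dist y x < d1 \<Longrightarrow> dist (?A y) (?A x) < ?e"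
      "d2 > 0" "\<And>y. dist y x < d2 \<Longrightarrow> dist (?B y) (?B x) < ?e"
    using e unfolding continuous_at_eps_delta by metis
  obtain d3 where d3: "d3 > 0" "ball x d3 \<subseteq> S"
    using assms(1,3) open_contains_ball by blast
  define r where "r = min d1 (min d2 d3)"
  \<comment> \<open>The parallelogram with sides \<open>h *\<^sub>R v\<close> and
    \<open>h *\<^sub>R w\<close> then stays within distance r of x, where either second derivative
    moves by less than half of the supposed gap. The added 1 keeps the denominator positive.\<close>
  define h where "h = r / (2 * (norm v + norm w + 1))"
  have r: "r > 0" using d d3 by (simp add: r_def)
  have N: "norm v + norm w + 1 > 0" by (smt (verit) norm_ge_zero)
  have h: "h > 0" using r N by (simp add: h_def)
  have near: "dist (x + s *\<^sub>R v + t *\<^sub>R w) x < r" if "0 \<le> s" "s \<le> h" "0 \<le> t" "t \<le> h" for s t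
  proof -
    have "dist (x + s *\<^sub>R v + t *\<^sub>R w) x = norm (s *\<^sub>R v + t *\<^sub>R w)"
      by (simp add: dist_norm add.assoc)
    also have "\<dots> \<le> s * norm v + t * norm w"
      using norm_triangle_ineq[of "s *\<^sub>R v" "t *\<^sub>R w"] that by simp
    also have "\<dots> \<le> h * norm v + h * norm w"
      using that by (intro add_mono mult_right_mono) auto
    also have "\<dots> \<le> h * (norm v + norm w + 1)" using h by (simp add: algebra_simps)
    also have "\<dots> = r / 2" using N by (simp add: h_def field_simps)
    finally show ?thesis using r by simp
  qed
  have S: "x + s *\<^sub>R v + t *\<^sub>R w \<in> S" "x + s *\<^sub>R w + t *\<^sub>R v \<in> S"
    if "0 \<le> s" "s \<le> h" "0 \<le> t" "t \<le> h" for s t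
    using near[OF that] near[of t s] that d3(2)
    by (auto simp: r_def dist_commute subset_eq add.commute add.left_commute)
  obtain s t where 1: "0 < s" "s < h" "0 < t" "t < h"
    "f (x + h *\<^sub>R v + h *\<^sub>R w) - f (x + h *\<^sub>R v) - f (x + h *\<^sub>R w) + f x =
      h\<^sup>2 * ?A (x + s *\<^sub>R v + t *\<^sub>R w)"
    using second_difference_mean_value[OF h S(1) assms(2)] by blast
  obtain s' t' where 2: "0 < s'" "s' < h" "0 < t'" "t' < h"
    "f (x + h *\<^sub>R w + h *\<^sub>R v) - f (x + h *\<^sub>R w) - f (x + h *\<^sub>R v) + f x =
      h\<^sup>2 * ?B (x + s' *\<^sub>R w + t' *\<^sub>R v)"
    using second_difference_mean_value[OF h S(2) assms(2)] by blast
  have "h\<^sup>2 * ?A (x + s *\<^sub>R v + t *\<^sub>R w) = h\<^sup>2 * ?B (x + s' *\<^sub>R w + t' *\<^sub>R v)"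
    unfolding 1(5)[symmetric] 2(5)[symmetric] by (simp add: algebra_simps)
  then have "?A (x + s *\<^sub>R v + t *\<^sub>R w) = ?B (x + s' *\<^sub>R w + t' *\<^sub>R v)" using h by simp
  moreover have "dist (?A (x + s *\<^sub>R v + t *\<^sub>R w)) (?A x) < ?e"
    using near[of s t] 1 by (intro d(2)) (auto simp: r_def)
  moreover have "dist (?B (x + s' *\<^sub>R w + t' *\<^sub>R v)) (?B x) < ?e"
    using near[of t' s'] 2 by (intro d(4)) (auto simp: r_def add.commute add.left_commute)
  ultimately show False by (simp add: dist_real_def) argo
qed

section \<open>Extension of smooth germs\<close>

lemma power_times_exp_neg_at_right:
  "((\<lambda>x::real. (1 / x) ^ n * exp (- (1 / x))) \<longlongrightarrow> 0) (at_right 0)"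
proof -
  have "((\<lambda>x::real. (inverse x) ^ n / exp (inverse x)) \<longlongrightarrow> 0) (at_right 0)"
    by (rule filterlim_compose[OF tendsto_power_div_exp_0 filterlim_inverse_at_top_right])
  then show ?thesis by (simp add: exp_minus divide_inverse)
qed

text \<open>The exponent n makes the family closed under differentiation up to linear combinations,
  so smoothness follows by induction on the order for all n at once.\<close>

definition flat_exp :: "nat \<Rightarrow> real \<Rightarrow> real" where
  "flat_exp n x = (if x > 0 then (1 / x) ^ n * exp (- (1 / x)) else 0)"

lemma flat_exp_DERIV:
  "(flat_exp n has_field_derivative flat_exp (n + 2) x - n * flat_exp (n + 1) x) (at x)"
proof -
  consider "x > 0" | "x < 0" | "x = 0" by linarith
  then show ?thesis
  proof cases
    case 1
    have "((\<lambda>x. (1 / x) ^ n * exp (- (1 / x))) has_field_derivative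
        flat_exp (n + 2) x - n * flat_exp (n + 1) x) (at x)"
      using 1
      by (auto intro!: derivative_eq_intros simp: flat_exp_def)
        (cases n; simp add: field_simps power2_eq_square)
    then show ?thesis
      by (rule has_field_derivative_transform_within_open[of _ _ _ "{0<..}"])
        (use 1 in \<open>auto simp: flat_exp_def\<close>)
  next
    case 2
    have "((\<lambda>x. 0) has_field_derivative flat_exp (n + 2) x - n * flat_exp (n + 1) x) (at x)"
      using 2 by (simp add: flat_exp_def)
    then show ?thesis
      by (rule has_field_derivative_transform_within_open[of _ _ _ "{..<0}"])
        (use 2 in \<open>auto simp: flat_exp_def\<close>)
  next
    case 3
    \<comment> \<open>To the right of 0 the difference quotient is again a member of the family,
      with exponent n + 1.\<close>
    have "((\<lambda>h. (flat_exp n (0 + h) - flat_exp n 0) / h) \<longlongrightarrow> 0) (at_right 0)"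
      by (rule Lim_transform_eventually[OF power_times_exp_neg_at_right[of "n + 1"]])
        (auto simp: flat_exp_def eventually_at_right_less intro!: eventually_at_rightI[of 0 1])
    moreover have "((\<lambda>h. (flat_exp n (0 + h) - flat_exp n 0) / h) \<longlongrightarrow> 0) (at_left 0)"
      by (rule Lim_transform_eventually[OF tendsto_const])
        (auto simp: flat_exp_def intro!: eventually_at_leftI[of "-1" 0])
    ultimately have "((\<lambda>h. (flat_exp n (0 + h) - flat_exp n 0) / h) \<longlongrightarrow> 0) (at 0)"
      using filterlim_split_at by blast
    then show ?thesis using 3 by (simp add: DERIV_def flat_exp_def)
  qed
qed

lemma Ck_on_flat_exp: "Ck_on k UNIV (flat_exp n)"
proof (induction k arbitrary: n)
  case 0
  then show ?case
    using DERIV_isCont[OF flat_exp_DERIV] by (simp add: continuous_on_eq_continuous_at)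
next
  case (Suc k)
  show ?case
  proof (rule Ck_on_SucI)
    show "(flat_exp n has_derivative (\<lambda>v. (flat_exp (n + 2) x + - real n * flat_exp (n + 1) x) * v)) (at x)" for x
      using flat_exp_DERIV[of n x] by (simp add: has_field_derivative_def)
    show "Ck_on k UNIV (\<lambda>x. (flat_exp (n + 2) x + - real n * flat_exp (n + 1) x) * v)" for v
      by (intro Ck_on_bilinear[OF _ bounded_bilinear_mult] Ck_on_add Ck_on_const Suc) auto
  qed auto
qed

lemma smooth_on_flat_exp: "smooth_on UNIV (flat_exp n)"
  using Ck_on_flat_exp by (simp add: smooth_on_def)

lemma smooth_cutoff:
  fixes a b :: real
  assumes "a < b"
  shows "\<exists>\<kappa>::real\<Rightarrow>real. smooth_on UNIV \<kappa> \<and> (\<forall>x. x \<le> a \<longrightarrow> \<kappa> x = 1) \<and> (\<forall>x. x \<ge> b \<longrightarrow> \<kappa> x = 0)"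
proof (intro exI conjI)
  let ?e = "flat_exp 0"
  let ?c = "\<lambda>x. ?e (b - x) / (?e (b - x) + ?e (x - a))"
  \<comment> \<open>Since a < b, no x satisfies both x \<ge> b and x \<le> a, so at least one
    summand is positive.\<close>
  have pos: "?e (b - x) + ?e (x - a) > 0" for x
    using assms by (auto simp: flat_exp_def intro: add_pos_pos)
  have "smooth_on UNIV (\<lambda>x. ?e (b - x))" "smooth_on UNIV (\<lambda>x. ?e (x - a))"
    by (rule smooth_on_compose[of _ UNIV]; auto intro!: smooth_on_intros smooth_on_flat_exp)+
  then show "smooth_on UNIV ?c"
    using pos by (intro smooth_on_divide smooth_on_add) (auto simp: less_imp_neq[symmetric])
  show "\<forall>x. x \<le> a \<longrightarrow> ?c x = 1" "\<forall>x. x \<ge> b \<longrightarrow> ?c x = 0"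
    using assms by (auto simp: flat_exp_def)
qed

lemma smooth_germ_extension:
  fixes g :: "real \<Rightarrow> real"
  assumes "smooth_on {a<..<b} g" "a < y" "y < b"
  shows "\<exists>G e. e > 0 \<and> smooth_on UNIV G \<and> (\<forall>x. \<bar>x - y\<bar> < e \<longrightarrow> G x = g x)"
proof -
  define r where "r = min (y - a) (b - y)"
  have r: "r > 0" using assms by (simp add: r_def)
  then have "(r / 3)\<^sup>2 < (r / 2)\<^sup>2" by (intro power_strict_mono) auto
  then obtain \<kappa> :: "real \<Rightarrow> real" where \<kappa>: "smooth_on UNIV \<kappa>" "\<And>x. x \<le> (r / 3)\<^sup>2 \<Longrightarrow> \<kappa> x = 1"
      "\<And>x. x \<ge> (r / 2)\<^sup>2 \<Longrightarrow> \<kappa> x = 0"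
    using smooth_cutoff by metis
  \<comment> \<open>The squared distance, unlike the distance, is smooth at y.\<close>
  define c where "c x = \<kappa> ((x - y) * (x - y))" for x
  have c: "smooth_on UNIV c"
    unfolding c_def by (rule smooth_on_compose[of _ UNIV]) (auto intro!: smooth_on_intros \<kappa>)
  have c1: "c x = 1" if "\<bar>x - y\<bar> < r / 3" for x
  proof -
    have "\<bar>x - y\<bar>\<^sup>2 \<le> (r / 3)\<^sup>2" using that by (intro power_mono) auto
    then show ?thesis by (simp add: c_def power2_eq_square \<kappa>(2))
  qed
  have c0: "c x = 0" if "\<bar>x - y\<bar> \<ge> r / 2" for x
  proof -
    have "\<bar>x - y\<bar>\<^sup>2 \<ge> (r / 2)\<^sup>2" using that r by (intro power_mono) auto
    then show ?thesis by (simp add: c_def power2_eq_square \<kappa>(3))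
  qed
  define G where "G x = (if x \<in> {a<..<b} then c x * g x else 0)" for x
  \<comment> \<open>G is smooth on the interval as a product and on \<open>?T\<close> because it
    vanishes there; the two open sets cover the line.\<close>
  let ?T = "- {y - r / 2..y + r / 2}"
  have "smooth_on {a<..<b} (\<lambda>x. c x * g x)"
    by (intro smooth_on_mult assms smooth_on_subset[OF c]) auto
  then have "smooth_on {a<..<b} G"
    by (rule smooth_on_cong[rotated 2]) (auto simp: G_def)
  moreover have "0 = G x" if "x \<in> ?T" for x
  proof -
    have "x < y - r / 2 \<or> x > y + r / 2" using that by auto
    then have "\<bar>x - y\<bar> \<ge> r / 2" by linarith
    then show ?thesis using c0 by (simp add: G_def)
  qed
  then have "smooth_on ?T G"
    by (rule smooth_on_cong[OF _ _ smooth_on_const, rotated]) auto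
  ultimately have "smooth_on ({a<..<b} \<union> ?T) G" by (intro smooth_on_Un) auto
  moreover have "{a<..<b} \<union> ?T = UNIV" using r by (auto simp: r_def min_def field_simps split: if_splits)
  moreover have "G x = g x" if "\<bar>x - y\<bar> < r / 3" for x
    using c1[OF that] that r by (auto simp: G_def r_def)
  ultimately show ?thesis using r by (intro exI[of _ G] exI[of _ "r / 3"]) auto
qed

text \<open>The derivative of D after the inverse of B is D' / B' after that same inverse, a
  function of the same shape. Leaving D arbitrary therefore lets the induction on the order close.
  It is used to write z - x y as a function of y when both are known as functions of a
  parameter.\<close>

lemma smooth_on_compose_inverse:
  fixes B D :: "real \<Rightarrow> real"
  assumes I: "open I" and B: "smooth_on I B" and inj: "inj_on B I"
    and nz: "\<And>t. t \<in> I \<Longrightarrow> deriv B t \<noteq> 0" and D: "smooth_on I D"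
  shows "smooth_on (B ` I) (\<lambda>s. D (the_inv_into I B s))"
proof -
  let ?b = "the_inv_into I B"
  have cont: "continuous_on I B" using B by (rule smooth_on_continuous_on)
  have op: "open (B ` I)" using invariance_of_domain[OF cont I inj] .
  have der: "((\<lambda>s. D (?b s)) has_derivative (\<lambda>v. deriv D (?b s) / deriv B (?b s) * v)) (at s)"
    if "s \<in> B ` I" and D: "smooth_on I D" for s and D :: "real \<Rightarrow> real"
  proof -
    from that(1) obtain t where t: "t \<in> I" "s = B t" by blast
    have b: "?b (B z) = z" if "z \<in> I" for z using the_inv_into_f_f[OF inj that] .
    have "(?b has_field_derivative inverse (deriv B t)) (at (B t))"
      unfolding has_field_derivative_def
      by (rule has_derivative_inverse_strong[OF I t(1) cont b
            smooth_on_DERIV[OF B t(1), unfolded has_field_derivative_def]])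
        (use nz[OF t(1)] in \<open>auto simp: fun_eq_iff\<close>)
    moreover have "(D has_field_derivative deriv D t) (at (?b (B t)))"
      using smooth_on_DERIV[OF D t(1)] b[OF t(1)] by simp
    ultimately have "((\<lambda>s. D (?b s)) has_field_derivative deriv D t * inverse (deriv B t)) (at (B t))"
      by (rule DERIV_chain2[rotated])
    then show ?thesis using t b by (simp add: has_field_derivative_def divide_inverse)
  qed
  have "Ck_on k (B ` I) (\<lambda>s. D (?b s))" if "smooth_on I D" for k and D :: "real \<Rightarrow> real"
    using that
  proof (induction k arbitrary: D)
    case 0
    then show ?case
      using has_derivative_continuous[OF der] by (auto simp: continuous_at_imp_continuous_on)
  next
    case (Suc k)
    show ?case
    proof (rule Ck_on_SucI[OF op der[OF _ Suc.prems]])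
      have "smooth_on I (\<lambda>t. deriv D t / deriv B t)"
        by (intro smooth_on_divide smooth_on_deriv I B Suc.prems nz)
      then show "Ck_on k (B ` I) (\<lambda>s. deriv D (?b s) / deriv B (?b s) * v)" for v
        by (intro Ck_on_bilinear[OF op bounded_bilinear_mult] Suc.IH Ck_on_const)
    qed
  qed
  then show ?thesis using D by (simp add: smooth_on_def)
qed

section \<open>Rigid motions in the left invariant frame\<close>

lemma contact_form_eq:
  "contact_form p v = snd (snd v) + fst p * fst (snd v) - fst (snd p) * fst v"
  by (cases p; cases v) (auto simp: contact_form_def)

lemma coframe_eq_iff:
  "coframe p v = coframe p w \<longleftrightarrow> v = w"
  by (auto simp: coframe_def contact_form_eq prod_eq_iff)

lemma linear_coframe: "linear (coframe p)"
  by (rule linearI) (auto simp: coframe_def contact_form_eq algebra_simps)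

lemma of_coframe_coframe: "of_coframe p (coframe p v) = v"
  by (cases p; cases v) (auto simp: of_coframe_def coframe_def frame1_def frame2_def reeb_def contact_form_eq)

lemma coframe_of_coframe: "coframe p (of_coframe p v) = v"
  by (cases p; cases v) (auto simp: of_coframe_def coframe_def frame1_def frame2_def reeb_def contact_form_eq algebra_simps)

lemma coframe_cplx: "coframe p (cplx p v) = (- fst (snd v), fst v, 0)"
  by (cases p; cases v) (auto simp: cplx_def coframe_def frame1_def frame2_def contact_form_eq)

lemma coframe_reeb: "coframe p (reeb p) = (0, 0, 1)"
  by (auto simp: coframe_def reeb_def contact_form_eq)

lemma cplx_simps:
  "fst (cplx p v) = - fst (snd v)" "fst (snd (cplx p v)) = fst v" "contact_form p (cplx p v) = 0"
  using coframe_cplx[of p v] by (simp_all add: coframe_def)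

lemma reeb_simps: "fst (reeb p) = 0" "fst (snd (reeb p)) = 0" "contact_form p (reeb p) = 1"
  using coframe_reeb[of p] by (simp_all add: coframe_def)

lemma contact_form_linear:
  "contact_form p (v + w) = contact_form p v + contact_form p w"
  "contact_form p (r *\<^sub>R v) = r * contact_form p v"
  by (simp_all add: contact_form_eq algebra_simps)

lemma adapted_metric_eq:
  "adapted_metric p v v = (fst v)\<^sup>2 + (fst (snd v))\<^sup>2 + (contact_form p v)\<^sup>2"
  by (simp add: adapted_metric_def coframe_def inner_prod_def power2_eq_square)

section \<open>The differential of a rigid motion\<close>

lemma frechet_derivative_linear:
  assumes "F differentiable (at p)" "bounded_linear L"
  shows "frechet_derivative (\<lambda>x. L (F x)) (at p) v = L (frechet_derivative F (at p) v)"
  using frechet_derivative_at[OF bounded_linear.has_derivative[OF assms(2)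
        assms(1)[unfolded frechet_derivative_works]]] by (simp add: fun_eq_iff)

lemma frechet_derivative_components:
  assumes "F differentiable (at p)"
  shows "frechet_derivative (\<lambda>x. fst (F x)) (at p) v = fst (frechet_derivative F (at p) v)"
    and "frechet_derivative (\<lambda>x. fst (snd (F x))) (at p) v = fst (snd (frechet_derivative F (at p) v))"
    and "frechet_derivative (\<lambda>x. snd (snd (F x))) (at p) v = snd (snd (frechet_derivative F (at p) v))"
proof -
  note fs = bounded_linear_compose[OF bounded_linear_fst bounded_linear_snd]
    and ss = bounded_linear_compose[OF bounded_linear_snd bounded_linear_snd]
  show "frechet_derivative (\<lambda>x. fst (F x)) (at p) v = fst (frechet_derivative F (at p) v)"
    by (rule frechet_derivative_linear[OF assms bounded_linear_fst])
  show "frechet_derivative (\<lambda>x. fst (snd (F x))) (at p) v = fst (snd (frechet_derivative F (at p) v))"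
    by (rule frechet_derivative_linear[OF assms fs])
  show "frechet_derivative (\<lambda>x. snd (snd (F x))) (at p) v = snd (snd (frechet_derivative F (at p) v))"
    by (rule frechet_derivative_linear[OF assms ss])
qed

text \<open>Commuting with J gives the horizontal block the form of multiplication by the complex
  number c + i s, and preservation of area on the contact plane gives it determinant 1. The numbers
  c and s are chosen for the single point p.\<close>

lemma rigid_motion_differential_coframe:
  assumes "rigid_motion \<phi>"
  shows "\<exists>c s. c\<^sup>2 + s\<^sup>2 = 1 \<and> (\<forall>v. coframe (\<phi> p) (frechet_derivative \<phi> (at p) v) =
    (c * fst v - s * fst (snd v), s * fst v + c * fst (snd v), contact_form p v))"
proof -
  define D where "D p = frechet_derivative \<phi> (at p)" for p
  have sm: "smooth_on UNIV \<phi>"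
    and ct: "\<And>p v. contact_form (\<phi> p) (D p v) = contact_form p v"
    and J: "\<And>p v. contact_form p v = 0 \<Longrightarrow> cplx (\<phi> p) (D p v) = D p (cplx p v)"
    using assms by (auto simp: rigid_motion_def D_def contact_plane_def)
  define f h k where "f x = fst (\<phi> x)" and "h x = fst (snd (\<phi> x))" and "k x = snd (snd (\<phi> x))" for x
  have smf: "smooth_on UNIV f" "smooth_on UNIV h" "smooth_on UNIV k"
    unfolding f_def h_def k_def by (intro smooth_on_intros sm open_UNIV)+
  have dif: "\<phi> differentiable (at x)" for x
    using smooth_on_has_derivative[OF sm UNIV_I] by (rule differentiableI)
  define F H K where "F v x = frechet_derivative f (at x) v" and "H v x = frechet_derivative h (at x) v"
    and "K v x = frechet_derivative k (at x) v" for v x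
  have comp: "fst (D x v) = F v x" "fst (snd (D x v)) = H v x" "snd (snd (D x v)) = K v x" for x v
    unfolding D_def F_def H_def K_def f_def h_def k_def
    by (simp_all add: frechet_derivative_components[OF dif])
  have eq: "K v x + f x * H v x - h x * F v x = snd (snd v) + fst x * fst (snd v) - fst (snd x) * fst v"
    for v x
    using ct[of x v] by (simp add: contact_form_eq comp f_def h_def)
  txt \<open>
    Differentiating the contact equation along \<open>w\<close> and antisymmetrising in \<open>v, w\<close> expresses that
    \<open>\<phi>\<close> preserves \<open>d\<Theta>\<close>, hence also its kernel, which is spanned by \<open>T\<close>.
  \<close>
  define F2 H2 K2 where "F2 v w x = frechet_derivative (F v) (at x) w"
    and "H2 v w x = frechet_derivative (H v) (at x) w"
    and "K2 v w x = frechet_derivative (K v) (at x) w" for v w x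
  have d: "(f has_derivative (\<lambda>w. F w x)) (at x)" "(h has_derivative (\<lambda>w. H w x)) (at x)"
    "(F v has_derivative (\<lambda>w. F2 v w x)) (at x)" "(H v has_derivative (\<lambda>w. H2 v w x)) (at x)"
    "(K v has_derivative (\<lambda>w. K2 v w x)) (at x)" for v x
    unfolding F_def H_def K_def F2_def H2_def K2_def
    by (auto intro!: smooth_on_has_derivative[where S=UNIV] smooth_on_frechet_derivative smf)
  have sym: "F2 v w x = F2 w v x" "H2 v w x = H2 w v x" "K2 v w x = K2 w v x" for v w x
    unfolding F_def H_def K_def F2_def H2_def K2_def
    by (rule symmetric_second_frechet_derivative[of UNIV]; auto intro: smf)+
  have eq2: "K2 v w x + (f x * H2 v w x + F w x * H v x) - (h x * F2 v w x + H w x * F v x) =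
      fst w * fst (snd v) - fst (snd w) * fst v" for v w x
  proof -
    have "((\<lambda>x. K v x + f x * H v x - h x * F v x) has_derivative
      (\<lambda>w. K2 v w x + (f x * H2 v w x + F w x * H v x) - (h x * F2 v w x + H w x * F v x))) (at x)"
      by (intro has_derivative_add has_derivative_diff has_derivative_mult d)
    moreover have "((\<lambda>x. K v x + f x * H v x - h x * F v x) has_derivative
      (\<lambda>w. fst w * fst (snd v) - fst (snd w) * fst v)) (at x)"
      unfolding eq by (auto intro!: derivative_eq_intros)
    ultimately show ?thesis by (rule fun_cong[OF has_derivative_unique])
  qed
  have area: "F w p * H v p - H w p * F v p = fst w * fst (snd v) - fst (snd w) * fst v" for v w
    using eq2[of v w p] eq2[of w v p] sym[of v w p] by (simp add: algebra_simps)
  let ?e1 = "frame1 p" and ?e2 = "frame2 p" and ?T = "reeb p"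
  have simps: "fst ?e1 = 1" "fst (snd ?e1) = 0" "fst ?e2 = 0" "fst (snd ?e2) = 1"
    "fst ?T = 0" "fst (snd ?T) = 0"
    by (cases p; simp add: frame1_def frame2_def reeb_def)+
  define c s where "c = F ?e1 p" and "s = H ?e1 p"
  have "contact_form p ?e1 = 0" "cplx p ?e1 = ?e2"
    by (cases p; simp add: frame1_def frame2_def contact_form_def cplx_def coframe_def)+
  then have "cplx (\<phi> p) (D p ?e1) = D p ?e2" using J by metis
  then have e2: "F ?e2 p = - s" "H ?e2 p = c"
    using cplx_simps[of "\<phi> p" "D p ?e1"] by (simp_all add: comp c_def s_def)
  have one: "c * c + s * s = 1"
    using area[of ?e1 ?e2] e2 by (simp add: simps c_def[symmetric] s_def[symmetric])
  \<comment> \<open>The horizontal part of the image of T has zero area with the images (c, s) and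
    (-s, c) of the two horizontal frame fields. These span the plane, so it vanishes.\<close>
  have T1: "F ?T p * c = - H ?T p * s" "F ?T p * s = H ?T p * c"
    using area[of ?T ?e1] area[of ?T ?e2] e2 by (simp_all add: simps c_def[symmetric] s_def[symmetric])
  have "F ?T p * (c * c + s * s) = 0" "H ?T p * (c * c + s * s) = 0"
    using T1 by algebra+
  then have T: "F ?T p = 0" "H ?T p = 0" using one by simp_all
  have "coframe (\<phi> p) (D p v) =
    (c * fst v - s * fst (snd v), s * fst v + c * fst (snd v), contact_form p v)" for v
  proof -
    have lin: "linear (D p)" unfolding D_def using dif by (rule linear_frechet_derivative)
    have "v = fst v *\<^sub>R ?e1 + fst (snd v) *\<^sub>R ?e2 + contact_form p v *\<^sub>R ?T"
      using of_coframe_coframe[of p v] by (simp add: of_coframe_def coframe_def)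
    then have "D p v = D p (fst v *\<^sub>R ?e1 + fst (snd v) *\<^sub>R ?e2 + contact_form p v *\<^sub>R ?T)"
      by (rule arg_cong)
    also have "\<dots> = fst v *\<^sub>R D p ?e1 + fst (snd v) *\<^sub>R D p ?e2 + contact_form p v *\<^sub>R D p ?T"
      by (simp add: linear_add[OF lin] linear_scale[OF lin])
    finally have "D p v = fst v *\<^sub>R D p ?e1 + fst (snd v) *\<^sub>R D p ?e2 + contact_form p v *\<^sub>R D p ?T" .
    from arg_cong[OF this, of fst] arg_cong[OF this, of "\<lambda>x. fst (snd x)"]
    have "F v p = c * fst v - s * fst (snd v)" "H v p = s * fst v + c * fst (snd v)"
      by (simp_all add: comp e2 T c_def[symmetric] s_def[symmetric])
    then show ?thesis by (simp add: coframe_def comp ct)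
  qed
  with one show ?thesis by (auto simp: D_def power2_eq_square)
qed

section \<open>Charts of open parts of a surface\<close>

lemma surface_chart_mono:
  "openin (top_of_set \<Sigma>) U \<Longrightarrow> surface_chart U V X \<Longrightarrow> surface_chart \<Sigma> V X"
  unfolding surface_chart_def using openin_trans by blast

lemma surface_chart_subset:
  assumes X: "surface_chart \<Sigma> V X" and V': "V' \<subseteq> V" "open V'"
    and U: "openin (top_of_set \<Sigma>) U" "X ` V' \<subseteq> U"
  shows "surface_chart U V' X"
proof -
  obtain Y where Y: "homeomorphism V (X ` V) X Y" and X': "openin (top_of_set \<Sigma>) (X ` V)"
    and sm: "smooth_on V X" and inj: "\<And>q. q \<in> V \<Longrightarrow> inj (frechet_derivative X (at q))"
    using X by (auto simp: surface_chart_def)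
  have "openin (top_of_set V) V'"
    using V' by (auto simp: openin_open)
  then have "openin (top_of_set (X ` V)) (X ` V')"
    using homeomorphism_imp_open_map[OF Y] by blast
  then have "openin (top_of_set \<Sigma>) (X ` V')"
    using X' openin_trans by blast
  then have "openin (top_of_set U) (X ` V')"
    using U openin_subset_trans openin_imp_subset by metis
  moreover have "homeomorphism V' (X ` V') X Y"
    using homeomorphism_of_subsets[OF Y V'(1) order_refl] by auto
  ultimately show ?thesis
    using V' smooth_on_subset[OF sm V'(1)] inj by (auto simp: surface_chart_def)
qed

lemma surface_chart_preimage:
  assumes "surface_chart \<Sigma> V X" "openin (top_of_set \<Sigma>) U"
  shows "open (V \<inter> X -` U)"
proof -
  obtain T where T: "open T" "U = \<Sigma> \<inter> T" using assms(2) by (auto simp: openin_open)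
  have "X ` V \<subseteq> \<Sigma>" using assms(1) unfolding surface_chart_def by (elim conjE openin_imp_subset)
  then have "V \<inter> X -` U = V \<inter> X -` T" using T by auto
  then show ?thesis
    using assms(1) T smooth_on_continuous_on
    by (auto simp: surface_chart_def intro!: continuous_open_preimage)
qed

lemma compatible_chart_subset:
  assumes "compatible_chart \<Sigma> V X a b" "V' \<subseteq> V" "open V'"
    "openin (top_of_set \<Sigma>) U" "X ` V' \<subseteq> U"
  shows "compatible_chart U V' X a b"
  using assms(1) surface_chart_subset[OF _ assms(2-5)] smooth_on_subset[OF _ assms(2), of "partial_x X"]
    subsetD[OF assms(2)]
  unfolding compatible_chart_def characteristic_field_def by simp

lemma alpha_type_II_subset:
  assumes "alpha_type_II V X c" "V' \<subseteq> V"
  shows "alpha_type_II V' X c"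
  using assms(1) smooth_on_subset[of "snd ` V" c "snd ` V'"] image_mono[OF assms(2), of snd] subsetD[OF assms(2)]
  unfolding alpha_type_II_def by simp

lemma normal_chart_subset:
  assumes "normal_chart \<Sigma> V X \<zeta>" "V' \<subseteq> V" "open V'"
    "openin (top_of_set \<Sigma>) U" "X ` V' \<subseteq> U"
  shows "normal_chart U V' X \<zeta>"
  using assms(1) compatible_chart_subset[OF _ assms(2-5)] alpha_type_II_subset[OF _ assms(2)]
  unfolding normal_chart_def by simp

lemma special_type_II_chart:
  assumes "special_type_II \<Sigma>" "p \<in> \<Sigma>"
  obtains V X a b c where "compatible_chart \<Sigma> V X a b" "p \<in> X ` V" "alpha_type_II V X c"
proof -
  have "\<exists>V X a b c. compatible_chart \<Sigma> V X a b \<and> p \<in> X ` V \<and> alpha_type_II V X c"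
    using assms by (simp add: special_type_II_def)
  with that show thesis by (elim exE conjE)
qed

text \<open>Conditions on all charts pass to U because charts of U are charts of \<Sigma>;
  conditions asking for a chart pass by shrinking the parameter domain to the preimage of U.\<close>

lemma special_type_II_open_subset:
  assumes \<Sigma>: "special_type_II \<Sigma>" and U: "openin (top_of_set \<Sigma>) U"
  shows "special_type_II U"
proof -
  have sub: "U \<subseteq> \<Sigma>" using U openin_imp_subset by blast
  have "embedded_surface U"
    unfolding embedded_surface_def
  proof
    fix p assume "p \<in> U"
    moreover have "embedded_surface \<Sigma>"
      using \<Sigma> by (simp add: special_type_II_def p_minimal_def)
    ultimately obtain V X where X: "surface_chart \<Sigma> V X" "p \<in> X ` V"
      using sub unfolding embedded_surface_def by blast
    have "surface_chart U (V \<inter> X -` U) X"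
      by (rule surface_chart_subset[OF X(1) _ surface_chart_preimage[OF X(1) U] U]) auto
    moreover have "p \<in> X ` (V \<inter> X -` U)" using X(2) \<open>p \<in> U\<close> by blast
    ultimately show "\<exists>V X. surface_chart U V X \<and> p \<in> X ` V" by blast
  qed
  moreover have "\<forall>q\<in>V. p_mean_curvature X E q = 0"
    if "surface_chart U V X" "characteristic_field V X E" for V X E
    using \<Sigma> surface_chart_mono[OF U that(1)] that(2)
    by (simp add: special_type_II_def p_minimal_def)
  ultimately have "p_minimal U"
    by (simp add: p_minimal_def)
  moreover have "no_singular_points U"
    unfolding no_singular_points_def
  proof (intro allI impI)
    fix V X assume "surface_chart U V X"
    then have "surface_chart \<Sigma> V X" by (rule surface_chart_mono[OF U])
    moreover have "no_singular_points \<Sigma>" using \<Sigma> by (simp add: special_type_II_def)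
    ultimately show "\<forall>q\<in>V. \<not> singular_at X q" unfolding no_singular_points_def by iprover
  qed
  moreover have "\<exists>V X a b c. compatible_chart U V X a b \<and> p \<in> X ` V \<and> alpha_type_II V X c"
    if "p \<in> U" for p
  proof -
    have "p \<in> \<Sigma>" using sub that by blast
    from special_type_II_chart[OF \<Sigma> this] obtain V X a b c
      where X: "compatible_chart \<Sigma> V X a b" "p \<in> X ` V" "alpha_type_II V X c" .
    let ?V = "V \<inter> X -` U"
    have "surface_chart \<Sigma> V X" using X(1) by (simp add: compatible_chart_def)
    then have "compatible_chart U ?V X a b"
      by (intro compatible_chart_subset[OF X(1) _ _ U] surface_chart_preimage[OF _ U]) auto
    moreover have "alpha_type_II ?V X c" by (rule alpha_type_II_subset[OF X(3)]) auto
    moreover have "p \<in> X ` ?V" using X(2) \<open>p \<in> U\<close> by blast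
    ultimately show ?thesis by (intro exI conjI)
  qed
  ultimately show ?thesis by (simp add: special_type_II_def)
qed

lemma symmetric_type_II_open_subset:
  assumes \<Sigma>: "symmetric_type_II \<Sigma>" and U: "openin (top_of_set \<Sigma>) U"
  shows "symmetric_type_II U"
proof -
  have sub: "U \<subseteq> \<Sigma>" using U openin_imp_subset by blast
  have "\<exists>V X \<zeta>. normal_chart U V X \<zeta> \<and> p \<in> X ` V \<and> \<zeta> constant_on (snd ` V)" if "p \<in> U" for p
  proof -
    obtain V X \<zeta> where X: "normal_chart \<Sigma> V X \<zeta>" "p \<in> X ` V" "\<zeta> constant_on (snd ` V)"
      using \<Sigma> sub \<open>p \<in> U\<close> unfolding symmetric_type_II_def by blast
    have "surface_chart \<Sigma> V X" using X(1) by (simp add: normal_chart_def compatible_chart_def)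
    then have "normal_chart U (V \<inter> X -` U) X \<zeta>"
      by (intro normal_chart_subset[OF X(1) _ _ U] surface_chart_preimage[OF _ U]) auto
    moreover have "\<zeta> constant_on (snd ` (V \<inter> X -` U))"
      using X(3) by (rule constant_on_subset) auto
    ultimately show ?thesis using X(2) \<open>p \<in> U\<close> by blast
  qed
  then show ?thesis
    using \<Sigma> special_type_II_open_subset[OF _ U] by (simp add: symmetric_type_II_def)
qed

text \<open>All equations come from sqrt(1 + \<alpha>^2) (a E + b P) = \<alpha> J E + T, expanded in
  the coframe. Its third component gives the normalisation and the sign of \<theta>; combining the
  other two with J E and E gives the rest. In the notation of the overview \<theta> is \<tau>, and
  the area identity is \<beta> = \<alpha> \<tau>.\<close>

lemma compatible_chart_frame:
  assumes "compatible_chart \<Sigma> V X a b" "q \<in> V"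
  defines "E \<equiv> partial_x X q" and "P \<equiv> partial_y X q" and "\<alpha> \<equiv> alpha X (partial_x X) q"
    and "\<theta> \<equiv> contact_form (X q) (partial_y X q)"
  shows "(fst E)\<^sup>2 + (fst (snd E))\<^sup>2 = 1" "contact_form (X q) E = 0" "\<theta> > 0"
    "fst E * fst (snd P) - fst (snd E) * fst P = \<alpha> * \<theta>"
    "b q * (fst E * fst P + fst (snd E) * fst (snd P)) = - a q"
    "b q * \<theta> * sqrt (1 + \<alpha>\<^sup>2) = 1"
proof -
  define r where "r = sqrt (1 + \<alpha>\<^sup>2)"
  have r: "r > 0" unfolding r_def by (rule real_sqrt_gt_zero) (rule add_pos_nonneg; simp)
  show h: "contact_form (X q) E = 0"
    using assms by (auto simp: compatible_chart_def characteristic_field_def contact_plane_def)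
  then show u: "(fst E)\<^sup>2 + (fst (snd E))\<^sup>2 = 1"
    using assms by (auto simp: compatible_chart_def characteristic_field_def adapted_metric_eq)
  have b: "b q > 0" and e2: "e2_hat X (partial_x X) q = a q *\<^sub>R E + b q *\<^sub>R P"
    using assms by (auto simp: compatible_chart_def)
  have "\<alpha> *\<^sub>R cplx (X q) E + reeb (X q) = r *\<^sub>R e2_hat X (partial_x X) q"
    unfolding e2_hat_def E_def[symmetric] \<alpha>_def[symmetric] r_def[symmetric] using r by simp
  then have "r *\<^sub>R (a q *\<^sub>R E + b q *\<^sub>R P) = \<alpha> *\<^sub>R cplx (X q) E + reeb (X q)"
    by (simp only: e2)
  from arg_cong[OF this, of "coframe (X q)"] h
  have "r * (a q * fst E + b q * fst P) = - \<alpha> * fst (snd E)"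
    "r * (a q * fst (snd E) + b q * fst (snd P)) = \<alpha> * fst E"
    "r * (b q * \<theta>) = 1"
    by (simp_all add: coframe_def contact_form_linear cplx_simps reeb_simps P_def \<theta>_def)
  then have 1: "r * (a q * fst E + b q * fst P) = - \<alpha> * fst (snd E)"
    and 2: "r * (a q * fst (snd E) + b q * fst (snd P)) = \<alpha> * fst E"
    and 3: "r * (b q * \<theta>) = 1" by simp_all
  show "b q * \<theta> * sqrt (1 + \<alpha>\<^sup>2) = 1"
    using 3 unfolding r_def[symmetric] by (simp only: ac_simps)
  show "\<theta> > 0" using 3 r b by (metis zero_less_mult_pos zero_less_one)
  have u': "fst E * fst E + fst (snd E) * fst (snd E) = 1" using u by (simp add: power2_eq_square)
  have "r * b q * (fst E * fst (snd P) - fst (snd E) * fst P) = \<alpha>"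
    using 1 2 u' by algebra
  also have "\<dots> = r * b q * (\<alpha> * \<theta>)" using 3 by algebra
  finally show "fst E * fst (snd P) - fst (snd E) * fst P = \<alpha> * \<theta>" using r b by simp
  have "r * (b q * (fst E * fst P + fst (snd E) * fst (snd P))) = r * - a q"
    using 1 2 u' by algebra
  then show "b q * (fst E * fst P + fst (snd E) * fst (snd P)) = - a q"
    using r by (metis mult_left_cancel less_irrefl)
qed

text \<open>Since e_1 has unit length, its derivative along itself in the parallel frame is a
  multiple of J e_1, and the factor is H.\<close>

lemma p_minimal_characteristics_straight:
  assumes \<Sigma>: "p_minimal \<Sigma>" and X: "compatible_chart \<Sigma> V X a b" and q: "q \<in> V"
  shows "frechet_derivative (\<lambda>r. fst (partial_x X r)) (at q) (1, 0) = 0"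
    and "frechet_derivative (\<lambda>r. fst (snd (partial_x X r))) (at q) (1, 0) = 0"
proof -
  let ?E = "partial_x X"
  define e1 e2 where "e1 r = fst (?E r)" and "e2 r = fst (snd (?E r))" for r
  have sc: "surface_chart \<Sigma> V X" and cf: "characteristic_field V X ?E"
    using X by (auto simp: compatible_chart_def)
  then have V: "open V" and sm: "smooth_on V ?E" and inj: "inj (frechet_derivative X (at q))"
    using q by (auto simp: surface_chart_def characteristic_field_def)
  have H: "p_mean_curvature X ?E q = 0" using \<Sigma> sc cf q by (auto simp: p_minimal_def)
  have sme: "smooth_on V e1" "smooth_on V e2"
    unfolding e1_def e2_def by (intro smooth_on_fst smooth_on_snd sm V)+
  define d1 d2 where "d1 = frechet_derivative e1 (at q) (1, 0)" and "d2 = frechet_derivative e2 (at q) (1, 0)"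
  note de = smooth_on_has_derivative[OF sme(1) q] smooth_on_has_derivative[OF sme(2) q]
  have E: "coframe (X r) (?E r) = (e1 r, e2 r, 0)" "(e1 r)\<^sup>2 + (e2 r)\<^sup>2 = 1" if "r \<in> V" for r
    using compatible_chart_frame(1,2)[OF X that] by (auto simp: coframe_def e1_def e2_def)
  have "((\<lambda>r. coframe (X r) (cplx (X r) (?E r))) has_derivative
      (\<lambda>v. (- frechet_derivative e2 (at q) v, frechet_derivative e1 (at q) v, 0))) (at q)"
    unfolding coframe_cplx e1_def[symmetric] e2_def[symmetric]
    by (intro has_derivative_Pair has_derivative_minus de has_derivative_const)
  then have "frechet_derivative (\<lambda>r. coframe (X r) (cplx (X r) (?E r))) (at q) =
      (\<lambda>v. (- frechet_derivative e2 (at q) v, frechet_derivative e1 (at q) v, 0))"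
    by (rule frechet_derivative_at[symmetric])
  \<comment> \<open>\<open>?E q\<close> is by definition the image of (1, 0), and the differential
    of a chart is injective.\<close>
  moreover have "(THE w. frechet_derivative X (at q) w = ?E q) = (1, 0)"
    by (rule the_equality) (use inj in \<open>auto simp: partial_x_def inj_def\<close>)
  ultimately have nabla: "nabla X ?E (\<lambda>r. cplx (X r) (?E r)) q = of_coframe (X q) (- d2, d1, 0)"
    by (simp add: nabla_def d1_def d2_def)
  have A: "((\<lambda>r. e1 r * e1 r + e2 r * e2 r) has_derivative
      (\<lambda>v. (e1 q * frechet_derivative e1 (at q) v + frechet_derivative e1 (at q) v * e1 q) +
        (e2 q * frechet_derivative e2 (at q) v + frechet_derivative e2 (at q) v * e2 q))) (at q)"
    by (intro has_derivative_add has_derivative_mult de)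
  have B: "((\<lambda>r. e1 r * e1 r + e2 r * e2 r) has_derivative (\<lambda>v. 0)) (at q)"
    by (rule has_derivative_transform_within_open[OF _ V q, of "\<lambda>r. 1"])
      (use E(2) in \<open>auto simp: power2_eq_square\<close>)
  have "e1 q * d1 + e2 q * d2 = 0"
    using fun_cong[OF has_derivative_unique[OF A B], of "(1, 0)"]
    unfolding d1_def[symmetric] d2_def[symmetric] by (simp add: algebra_simps)
  moreover have one: "e1 q * e1 q + e2 q * e2 q = 1" using E(2)[OF q] by (simp add: power2_eq_square)
  ultimately have d: "d1 = - (e1 q * d2 - e2 q * d1) * e2 q" "d2 = (e1 q * d2 - e2 q * d1) * e1 q"
    by algebra+
  \<comment> \<open>The equivalence gives existence and uniqueness for the definite description in
    \<open>p_mean_curvature\<close> at once.\<close>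
  have eq: "of_coframe (X q) (- d2, d1, 0) = - (h *\<^sub>R ?E q) \<longleftrightarrow> h = e1 q * d2 - e2 q * d1" for h
  proof -
    have "of_coframe (X q) (- d2, d1, 0) = - (h *\<^sub>R ?E q) \<longleftrightarrow>
      coframe (X q) (of_coframe (X q) (- d2, d1, 0)) = coframe (X q) (- (h *\<^sub>R ?E q))"
      by (rule coframe_eq_iff[symmetric])
    also have "coframe (X q) (- (h *\<^sub>R ?E q)) = (- h * e1 q, - h * e2 q, 0)"
      using linear_coframe[of "X q"] E(1)[OF q] by (simp add: linear_neg linear_scale)
    finally have "of_coframe (X q) (- d2, d1, 0) = - (h *\<^sub>R ?E q) \<longleftrightarrow>
      d2 = h * e1 q \<and> d1 = - h * e2 q" by (auto simp: coframe_of_coframe)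
    moreover have "d2 = h * e1 q \<and> d1 = - h * e2 q \<longleftrightarrow> h = e1 q * d2 - e2 q * d1"
      using d one by algebra
    ultimately show ?thesis by simp
  qed
  then have "p_mean_curvature X ?E q = e1 q * d2 - e2 q * d1"
    unfolding p_mean_curvature_def nabla by simp
  then show "frechet_derivative (\<lambda>r. fst (?E r)) (at q) (1, 0) = 0"
    "frechet_derivative (\<lambda>r. fst (snd (?E r))) (at q) (1, 0) = 0"
    using H d by (simp_all add: d1_def[symmetric] d2_def[symmetric] e1_def[symmetric] e2_def[symmetric])
qed

section \<open>Rotations about the vertical axis and translations\<close>

text \<open>The rotation taking the horizontal direction (c, s) to (1, 0), followed by left
  translation by (a, 0, e); the last term of the third coordinate comes from the group law.\<close>

definition planar_motion :: "real \<Rightarrow> real \<Rightarrow> real \<Rightarrow> real \<Rightarrow> heis \<Rightarrow> heis" where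
  "planar_motion c s a e p =
    (c * fst p + s * fst (snd p) + a, c * fst (snd p) - s * fst p,
     snd (snd p) + e - a * (c * fst (snd p) - s * fst p))"

lemma rigid_motion_planar_motion:
  assumes cs: "c\<^sup>2 + s\<^sup>2 = 1"
  shows "rigid_motion (planar_motion c s a e)"
proof -
  let ?M = "planar_motion c s a e"
  define N :: "heis \<Rightarrow> heis" where
    "N p = (c * (fst p - a) - s * fst (snd p), s * (fst p - a) + c * fst (snd p),
      snd (snd p) - e + a * fst (snd p))" for p
  have cs': "c * c + s * s = 1" using cs by (simp add: power2_eq_square)
  have NM: "N (?M p) = p" for p
  proof -
    have "c * (c * x + s * y) - s * (c * y - s * x) = x" "s * (c * x + s * y) + c * (c * y - s * x) = y"
      for x y :: real using cs' by algebra+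
    then show ?thesis by (simp add: planar_motion_def N_def prod_eq_iff)
  qed
  have MN: "?M (N p) = p" for p
  proof -
    have 1: "c * (c * x - s * y) + s * (s * x + c * y) = x" "c * (s * x + c * y) - s * (c * x - s * y) = y"
      for x y :: real using cs' by algebra+
    show ?thesis unfolding planar_motion_def N_def fst_conv snd_conv 1 by simp
  qed
  have bij: "bij ?M" using NM MN by (intro o_bij[of N]) (auto simp: fun_eq_iff)
  have inv: "inv ?M = N" using MN NM by (metis (no_types, lifting) ext inv_f_f bij bij_is_inj)
  have "smooth_on UNIV ?M" "smooth_on UNIV N"
    unfolding planar_motion_def N_def by (intro smooth_on_intros open_UNIV)+
  moreover
  have D: "frechet_derivative ?M (at p) v = (c * fst v + s * fst (snd v), c * fst (snd v) - s * fst v,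
     snd (snd v) - a * (c * fst (snd v) - s * fst v))" for p v
  proof -
    have "(?M has_derivative (\<lambda>v. (c * fst v + s * fst (snd v), c * fst (snd v) - s * fst v,
      snd (snd v) - a * (c * fst (snd v) - s * fst v)))) (at p)"
      unfolding planar_motion_def
      by (intro has_derivative_Pair) (auto intro!: derivative_eq_intros)
    from fun_cong[OF frechet_derivative_at[OF this], of v] show ?thesis by simp
  qed
  have ct: "contact_form (?M p) (frechet_derivative ?M (at p) v) = contact_form p v" for p v
  proof -
    have "z - a * (c * w - s * u) + (c * x + s * y + a) * (c * w - s * u) - (c * y - s * x) * (c * u + s * w)
       = z + x * w - y * u" for x y z u w :: real
      using cs' by algebra
    then show ?thesis
      by (simp add: D contact_form_eq planar_motion_def)
  qed
  moreover have "cplx (?M p) (frechet_derivative ?M (at p) v) = frechet_derivative ?M (at p) (cplx p v)"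
    if "contact_form p v = 0" for p v
  proof -
    have "coframe (?M p) (cplx (?M p) (frechet_derivative ?M (at p) v)) =
      coframe (?M p) (frechet_derivative ?M (at p) (cplx p v))"
      unfolding coframe_def ct cplx_simps by (simp add: D cplx_simps)
    then show ?thesis by (simp only: coframe_eq_iff)
  qed
  ultimately show ?thesis
    using bij inv by (simp add: rigid_motion_def contact_plane_def)
qed

section \<open>Type II surfaces are locally graphs\<close>

lemma frechet_derivative_real_simps:
  fixes F G :: "'a::real_normed_vector \<Rightarrow> real"
  assumes "smooth_on V F" "smooth_on V G" "q \<in> V"
  shows "frechet_derivative (\<lambda>r. F r * G r) (at q) v =
      F q * frechet_derivative G (at q) v + frechet_derivative F (at q) v * G q"
    and "frechet_derivative (\<lambda>r. F r + G r) (at q) v =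
      frechet_derivative F (at q) v + frechet_derivative G (at q) v"
    and "frechet_derivative (\<lambda>r. F r - G r) (at q) v =
      frechet_derivative F (at q) v - frechet_derivative G (at q) v"
  by (rule fun_cong[OF frechet_derivative_at[symmetric]],
      intro has_derivative_mult has_derivative_add has_derivative_diff
        smooth_on_has_derivative[OF assms(1,3)] smooth_on_has_derivative[OF assms(2,3)])+

lemma frechet_derivative_cong_on:
  assumes "open V" "smooth_on V F" "q \<in> V" "\<And>r. r \<in> V \<Longrightarrow> F r = G r"
  shows "frechet_derivative F (at q) v = frechet_derivative G (at q) v"
proof -
  have "F differentiable (at q)"
    using smooth_on_has_derivative[OF assms(2,3)] by (rule differentiableI)
  from frechet_derivative_transform_within_open[OF this assms(1,3,4)] show ?thesis by simp
qed

lemma DERIV_slices: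
  fixes F :: "real \<times> real \<Rightarrow> real"
  assumes "smooth_on V F" "(x, y) \<in> V"
  shows "((\<lambda>t. F (t, y)) has_field_derivative frechet_derivative F (at (x, y)) (1, 0)) (at x)"
    and "((\<lambda>t. F (x, t)) has_field_derivative frechet_derivative F (at (x, y)) (0, 1)) (at y)"
proof -
  let ?D = "frechet_derivative F (at (x, y))"
  note D = smooth_on_has_derivative[OF assms]
  have lin: "?D (t, 0) = t * ?D (1, 0)" "?D (0, t) = t * ?D (0, 1)" for t
    using linear_scale[OF has_derivative_linear[OF D], of t "(1, 0)"]
      linear_scale[OF has_derivative_linear[OF D], of t "(0, 1)"] by simp_all
  have e: "(\<lambda>t. ?D (t, 0)) = (*) (?D (1, 0))" "(\<lambda>t. ?D (0, t)) = (*) (?D (0, 1))"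
    by (rule ext, rule trans[OF lin(1) mult.commute], rule ext, rule trans[OF lin(2) mult.commute])
  have 1: "((\<lambda>t. (t, y)) has_derivative (\<lambda>t. (t, 0))) (at x)"
    and 2: "((\<lambda>t. (x, t)) has_derivative (\<lambda>t. (0, t))) (at y)"
    by (intro has_derivative_Pair has_derivative_ident has_derivative_const)+
  show "((\<lambda>t. F (t, y)) has_field_derivative ?D (1, 0)) (at x)"
    using has_derivative_compose[OF 1 D] unfolding has_field_derivative_def e .
  show "((\<lambda>t. F (x, t)) has_field_derivative ?D (0, 1)) (at y)"
    using has_derivative_compose[OF 2 D] unfolding has_field_derivative_def e .
qed

lemma constant_along_rows:
  fixes F :: "real \<times> real \<Rightarrow> real"
  assumes "smooth_on V F" "convex I" "I \<times> {y} \<subseteq> V"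
    and "\<And>x. x \<in> I \<Longrightarrow> frechet_derivative F (at (x, y)) (1, 0) = 0" "x \<in> I" "x' \<in> I"
  shows "F (x, y) = F (x', y)"
proof -
  have "((\<lambda>t. F (t, y)) has_field_derivative 0) (at t within I)" if "t \<in> I" for t
    using DERIV_slices(1)[OF assms(1), of t y] assms(3,4) that
    by (metis has_field_derivative_at_within mem_Sigma_iff singletonI subsetD)
  from has_field_derivative_zero_constant[OF assms(2) this] assms(5,6) show ?thesis by metis
qed

text \<open>The derivative of e_1 in x vanishes by p-minimality. Of its derivative in y, the
  component along e_1 vanishes by unit length, and the component along J e_1 equals the x-derivative
  of \<beta>.\<close>

lemma type_II_characteristics_parallel:
  assumes \<Sigma>: "p_minimal \<Sigma>" and X: "compatible_chart \<Sigma> V X a b" and al: "alpha_type_II V X \<zeta>"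
    and q: "q \<in> V"
  shows "((\<lambda>r. fst (partial_x X r)) has_derivative (\<lambda>v. 0)) (at q)"
    and "((\<lambda>r. fst (snd (partial_x X r))) has_derivative (\<lambda>v. 0)) (at q)"
proof -
  define D where "D F v r = frechet_derivative F (at r) v"
    for F :: "real \<times> real \<Rightarrow> real" and v r
  let ?e = "(1, 0) :: real \<times> real" and ?d = "(0, 1) :: real \<times> real"
  have V: "open V" and smX: "smooth_on V X"
    using X by (auto simp: compatible_chart_def surface_chart_def)
  define f h k where "f r = fst (X r)" and "h r = fst (snd (X r))" and "k r = snd (snd (X r))" for r
  have sm: "smooth_on V f" "smooth_on V h" "smooth_on V k"
    unfolding f_def h_def k_def by (intro smooth_on_fst smooth_on_snd smX V)+
  have smD: "smooth_on V (D F v)" if "smooth_on V F" for F v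
    unfolding D_def by (rule smooth_on_frechet_derivative[OF that])
  note mult = frechet_derivative_real_simps(1)[where V=V, folded D_def]
    and add = frechet_derivative_real_simps(2)[where V=V, folded D_def]
    and diff = frechet_derivative_real_simps(3)[where V=V, folded D_def]
    and cong = frechet_derivative_cong_on[OF V, where 'b=real, folded D_def]
    and sym2 = symmetric_second_frechet_derivative[OF V, folded D_def]
  have comp: "D f v r = fst (frechet_derivative X (at r) v)"
    "D h v r = fst (snd (frechet_derivative X (at r) v))"
    "D k v r = snd (snd (frechet_derivative X (at r) v))" if "r \<in> V" for v r
    unfolding D_def f_def h_def k_def
    by (rule frechet_derivative_components differentiableI[OF smooth_on_has_derivative[OF smX that]])+
  define \<beta> \<tau> where "\<beta> r = D f ?e r * D h ?d r - D h ?e r * D f ?d r"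
    and "\<tau> r = D k ?d r + f r * D h ?d r - h r * D f ?d r" for r
  \<comment> \<open>\<open>m\<close> is 1 / \<alpha>: the relation between \<alpha>, \<beta> and
    \<tau> becomes the product \<open>\<beta> r * m r = \<tau> r\<close>, convenient to
    differentiate.\<close>
  define m where "m r = 2 * fst r + \<zeta> (snd r)" for r :: "real \<times> real"
  note fr = compatible_chart_frame[OF X]
  have unit: "D f ?e r * D f ?e r + D h ?e r * D h ?e r = 1"
    and hor: "D k ?e r = h r * D f ?e r - f r * D h ?e r"
    and eq: "\<beta> r * m r = \<tau> r" and m: "m r \<noteq> 0" if "r \<in> V" for r
  proof -
    show "D f ?e r * D f ?e r + D h ?e r * D h ?e r = 1"
      using fr(1)[OF that] comp[OF that] by (simp add: partial_x_def power2_eq_square)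
    show "D k ?e r = h r * D f ?e r - f r * D h ?e r"
      using fr(2)[OF that] comp[OF that] by (simp add: partial_x_def contact_form_eq f_def h_def)
    have al': "m r \<noteq> 0" "alpha X (partial_x X) r = 1 / m r"
      using al that by (auto simp: alpha_type_II_def m_def)
    then show "m r \<noteq> 0" by blast
    have "contact_form (X r) (partial_y X r) = \<tau> r"
      using comp[OF that] by (simp add: partial_y_def contact_form_eq f_def h_def \<tau>_def)
    then have "\<beta> r = alpha X (partial_x X) r * \<tau> r"
      using fr(4)[OF that] comp[OF that] by (simp add: partial_x_def partial_y_def \<beta>_def)
    then show "\<beta> r * m r = \<tau> r" using al' by simp
  qed
  have "open (snd ` V)" by (rule open_image_snd[OF V])
  then have smm: "smooth_on V m"
    unfolding m_def using al V
    by (intro smooth_on_intros smooth_on_compose[of V "snd ` V" snd \<zeta>])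
      (auto simp: alpha_type_II_def)
  have "((\<lambda>t. m (t, snd q)) has_field_derivative 2) (at (fst q))"
    unfolding m_def by (auto intro!: derivative_eq_intros)
  moreover have "((\<lambda>t. m (t, snd q)) has_field_derivative D m ?e q) (at (fst q))"
    using DERIV_slices(1)[OF smm, of "fst q" "snd q"] q by (simp add: D_def)
  ultimately have m2: "D m ?e q = 2" by (rule DERIV_unique[THEN sym])
  note smV = sm smD smooth_on_mult[OF V] smooth_on_add[OF V] smooth_on_diff[OF V] V
  have A: "D f ?e q * D (D f ?e) ?d q + D h ?e q * D (D h ?e) ?d q = 0"
  proof -
    have "D (\<lambda>r. D f ?e r * D f ?e r + D h ?e r * D h ?e r) ?d q = D (\<lambda>r. 1) ?d q"
      by (rule cong) (intro smV q unit | rule q)+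
    then show ?thesis
      by (simp add: add mult smV q) (simp add: D_def algebra_simps)
  qed
  \<comment> \<open>The horizontality of the first coordinate field, differentiated in y; it
    supplies the mixed derivative of the z-coordinate that occurs in the x-derivative of
    \<tau>.\<close>
  have K: "D (D k ?e) ?d q = h q * D (D f ?e) ?d q + D h ?d q * D f ?e q
      - (f q * D (D h ?e) ?d q + D f ?d q * D h ?e q)"
  proof -
    have "D (D k ?e) ?d q = D (\<lambda>r. h r * D f ?e r - f r * D h ?e r) ?d q"
      by (rule cong) (intro smV q hor | rule q)+
    then show ?thesis by (simp add: diff mult smV q)
  qed
  have L: "D \<beta> ?e q * m q + \<beta> q * 2 = D \<tau> ?e q"
  proof -
    have sb: "smooth_on V \<beta>" unfolding \<beta>_def by (intro smV)
    have "D (\<lambda>r. \<beta> r * m r) ?e q = D \<tau> ?e q"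
      by (rule cong) (intro smV sb smm q eq | rule q)+
    then show ?thesis by (simp add: mult sb smm q m2)
  qed
  have z: "D (D f ?e) ?e q = 0" "D (D h ?e) ?e q = 0"
  proof -
    have "smooth_on V (partial_x X)"
      using X by (simp add: compatible_chart_def characteristic_field_def)
    then have s: "smooth_on V (\<lambda>r. fst (partial_x X r))" "smooth_on V (\<lambda>r. fst (snd (partial_x X r)))"
      by (intro smooth_on_fst smooth_on_snd V; assumption)+
    have "D (\<lambda>r. fst (partial_x X r)) ?e q = D (D f ?e) ?e q"
      "D (\<lambda>r. fst (snd (partial_x X r))) ?e q = D (D h ?e) ?e q"
      by (rule cong[OF s(1) q] cong[OF s(2) q]; simp add: comp partial_x_def)+
    then show "D (D f ?e) ?e q = 0" "D (D h ?e) ?e q = 0"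
      using p_minimal_characteristics_straight[OF \<Sigma> X q] by (simp_all add: D_def)
  qed
  have "D \<beta> ?e q = D f ?e q * D (D h ?e) ?d q - D h ?e q * D (D f ?e) ?d q"
    unfolding \<beta>_def using z sym2[OF sm(1) q, of ?e ?d] sym2[OF sm(2) q, of ?e ?d]
    by (simp add: diff mult smV q)
  moreover have "D \<tau> ?e q = 2 * \<beta> q"
    unfolding \<tau>_def \<beta>_def using K sym2[OF sm(1) q, of ?e ?d] sym2[OF sm(2) q, of ?e ?d] sym2[OF sm(3) q, of ?e ?d]
    by (simp add: diff add mult smV q algebra_simps)
  ultimately have "D f ?e q * D (D h ?e) ?d q - D h ?e q * D (D f ?e) ?d q = 0"
    using L m[OF q] by simp
  \<comment> \<open>The y-derivative of the unit direction is orthogonal to that direction by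
    \<open>A\<close>, and parallel to it by the equation just obtained.\<close>
  with A unit[OF q] have d: "D (D f ?e) ?d q = 0" "D (D h ?e) ?d q = 0" by algebra+
  have zero: "((\<lambda>r. G r) has_derivative (\<lambda>v. 0)) (at q)"
    if F: "smooth_on V F" "D F ?e q = 0" "D F ?d q = 0" and G: "\<And>r. r \<in> V \<Longrightarrow> F r = G r" for F G
  proof -
    have F': "(F has_derivative (\<lambda>v. D F v q)) (at q)"
      using smooth_on_has_derivative[OF F(1) q] by (simp add: D_def)
    have "D F v q = 0" for v
    proof -
      have "v = fst v *\<^sub>R ?e + snd v *\<^sub>R ?d" by (simp add: prod_eq_iff)
      then have "D F v q = D F (fst v *\<^sub>R ?e + snd v *\<^sub>R ?d) q" by simp
      also have "\<dots> = fst v *\<^sub>R D F ?e q + snd v *\<^sub>R D F ?d q"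
        by (simp only: has_derivative_linear[OF F', THEN linear_add]
            has_derivative_linear[OF F', THEN linear_scale])
      finally show ?thesis using F by simp
    qed
    then have "(F has_derivative (\<lambda>v. 0)) (at q)" using F' by simp
    from has_derivative_transform_within_open[OF this V q G] show ?thesis by simp
  qed
  show "((\<lambda>r. fst (partial_x X r)) has_derivative (\<lambda>v. 0)) (at q)"
    by (rule zero[OF smD[OF sm(1)] z(1) d(1)]) (simp add: comp partial_x_def)
  show "((\<lambda>r. fst (snd (partial_x X r))) has_derivative (\<lambda>v. 0)) (at q)"
    by (rule zero[OF smD[OF sm(2)] z(2) d(2)]) (simp add: comp partial_x_def)
qed

section \<open>From parallel characteristics to a graph\<close>

lemma injective_if_deriv_nonzero:
  fixes B :: "real \<Rightarrow> real"
  assumes "convex J" "\<And>t. t \<in> J \<Longrightarrow> (B has_field_derivative B' t) (at t)" "\<And>t. t \<in> J \<Longrightarrow> B' t \<noteq> 0"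
  shows "inj_on B J"
proof (rule linorder_inj_onI')
  fix s t assume st: "s \<in> J" "t \<in> J" "s < t"
  have J: "z \<in> J" if "s \<le> z" "z \<le> t" for z
    using assms(1) st that by (meson convex_contains_segment closed_segment_eq_real_ivl
        atLeastAtMost_iff convex_closed_interval is_interval_convex_1 mem_is_interval_1_I)
  obtain z where "s < z" "z < t" "B t - B s = (t - s) * B' z"
    using MVT2[of s t B B'] st assms(2) J by blast
  then show "B s \<noteq> B t" using assms(3)[of z] J[of z] st by auto
qed

lemma open_contains_square:
  assumes "open V" "(x, y) \<in> V"
  obtains r :: real where "r > 0" "{x - r<..<x + r} \<times> {y - r<..<y + r} \<subseteq> V"
proof -
  obtain A B where AB: "open A" "open B" "x \<in> A" "y \<in> B" "A \<times> B \<subseteq> V"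
    using open_prod_elim[OF assms] by (metis mem_Sigma_iff)
  obtain r1 r2 where r: "r1 > 0" "ball x r1 \<subseteq> A" "r2 > 0" "ball y r2 \<subseteq> B"
    using AB open_contains_ball by metis
  let ?r = "min r1 r2"
  have "{x - ?r<..<x + ?r} \<subseteq> ball x r1" "{y - ?r<..<y + ?r} \<subseteq> ball y r2"
    by (auto simp: dist_real_def)
  then have "{x - ?r<..<x + ?r} \<times> {y - ?r<..<y + ?r} \<subseteq> V" using AB(5) r by blast
  then show thesis using that[of ?r] r by simp
qed

text \<open>After the rotation, y and z - x y are functions B and W of the second parameter alone,
  and B has nonzero derivative; so g is W after the inverse of B near the point, extended to the
  line. Connectedness of U is recorded for the discussion of symmetry.\<close>

lemma special_type_II_local_graph:
  assumes \<Sigma>: "special_type_II \<Sigma>" and p: "p \<in> \<Sigma>"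
  obtains c s U g where "c\<^sup>2 + s\<^sup>2 = 1" "openin (top_of_set \<Sigma>) U" "p \<in> U" "connected U"
    "smooth_on UNIV g" "planar_motion c s 0 0 ` U \<subseteq> graph (\<lambda>x y. x * y + g y)"
proof -
  obtain V X a b \<zeta> where X: "compatible_chart \<Sigma> V X a b" "p \<in> X ` V" "alpha_type_II V X \<zeta>"
    using special_type_II_chart[OF \<Sigma> p] .
  have pm: "p_minimal \<Sigma>" using \<Sigma> by (simp add: special_type_II_def)
  have sc: "surface_chart \<Sigma> V X" using X(1) by (simp add: compatible_chart_def)
  then have V: "open V" and smX: "smooth_on V X" by (auto simp: surface_chart_def)
  obtain x0 y0 where q0: "(x0, y0) \<in> V" "p = X (x0, y0)" using X(2) by auto
  obtain r where r: "r > 0" "{x0 - r<..<x0 + r} \<times> {y0 - r<..<y0 + r} \<subseteq> V"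
    using open_contains_square[OF V q0(1)] .
  \<comment> \<open>On a rectangle the rows are intervals, so a vanishing x-derivative means
    dependence on the second coordinate only.\<close>
  define I J where "I = {x0 - r<..<x0 + r}" and "J = {y0 - r<..<y0 + r}"
  have IJ: "I \<times> J \<subseteq> V" "x0 \<in> I" "y0 \<in> J" "convex I" "convex J" "open I" "open J"
    using r by (auto simp: I_def J_def)
  have cIJ: "convex (I \<times> J)" using IJ by (intro convex_Times)
  define D where "D F v r = frechet_derivative F (at r) v"
    for F :: "real \<times> real \<Rightarrow> real" and v r
  let ?e = "(1, 0) :: real \<times> real" and ?d = "(0, 1) :: real \<times> real"
  define f h k where "f r = fst (X r)" and "h r = fst (snd (X r))" and "k r = snd (snd (X r))" for r
  have sm: "smooth_on V f" "smooth_on V h" "smooth_on V k"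
    unfolding f_def h_def k_def by (intro smooth_on_fst smooth_on_snd smX V)+
  note add = frechet_derivative_real_simps(2)[where V=V, folded D_def]
    and diff = frechet_derivative_real_simps(3)[where V=V, folded D_def]
    and mult = frechet_derivative_real_simps(1)[where V=V, folded D_def]
  have comp: "D f v r = fst (frechet_derivative X (at r) v)"
    "D h v r = fst (snd (frechet_derivative X (at r) v))"
    "D k v r = snd (snd (frechet_derivative X (at r) v))" if "r \<in> V" for v r
    unfolding D_def f_def h_def k_def
    by (rule frechet_derivative_components differentiableI[OF smooth_on_has_derivative[OF smX that]])+
  note par = type_II_characteristics_parallel[OF pm X(1) X(3)]
  obtain c s where cs: "\<And>r. r \<in> I \<times> J \<Longrightarrow> D f ?e r = c" "\<And>r. r \<in> I \<times> J \<Longrightarrow> D h ?e r = s"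
  proof -
    have "\<exists>c. \<forall>r\<in>I \<times> J. fst (partial_x X r) = c" "\<exists>s. \<forall>r\<in>I \<times> J. fst (snd (partial_x X r)) = s"
      by (rule has_derivative_zero_constant[OF cIJ]; rule has_derivative_at_withinI;
          use par IJ(1) in blast)+
    then obtain c s where "\<forall>r\<in>I \<times> J. fst (partial_x X r) = c" "\<forall>r\<in>I \<times> J. fst (snd (partial_x X r)) = s"
      by blast
    with IJ(1) show thesis by (intro that[of c s]) (auto simp: comp partial_x_def subset_eq)
  qed
  note fr = compatible_chart_frame[OF X(1)]
  have one: "c * c + s * s = 1"
    using fr(1)[OF q0(1)] cs[of "(x0, y0)"] IJ q0(1) by (simp add: comp partial_x_def power2_eq_square)
  have hor: "D k ?e q = h q * c - f q * s"
    and trans: "c * D h ?d q - s * D f ?d q \<noteq> 0" if q: "q \<in> I \<times> J" for q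
  proof -
    have qV: "q \<in> V" using q IJ by blast
    show "D k ?e q = h q * c - f q * s"
      using fr(2)[OF qV] cs[OF q] comp[OF qV] by (simp add: partial_x_def contact_form_eq f_def h_def)
    have "alpha X (partial_x X) q \<noteq> 0" using X(3) qV by (auto simp: alpha_type_II_def)
    then show "c * D h ?d q - s * D f ?d q \<noteq> 0"
      using fr(3,4)[OF qV] cs[OF q] comp[OF qV] by (simp add: partial_x_def partial_y_def)
  qed
  \<comment> \<open>The horizontal coordinates after the rotation by (c, s), and the height above
    the graph of x y.\<close>
  define F G u where "F q = c * f q + s * h q" and "G q = c * h q - s * f q"
    and "u q = k q - F q * G q" for q
  have smF: "smooth_on V F" unfolding F_def by (intro smooth_on_intros sm V)
  have smG: "smooth_on V G" unfolding G_def by (intro smooth_on_intros sm V)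
  have smu: "smooth_on V u" unfolding u_def by (intro smooth_on_intros sm smF smG V)
  have DF: "D F v q = c * D f v q + s * D h v q" and DG: "D G v q = c * D h v q - s * D f v q"
    if "q \<in> V" for v q
    unfolding F_def G_def using that
    by (simp_all add: add diff mult sm V smooth_on_mult smooth_on_const) (simp_all add: D_def)
  have De: "D G ?e q = 0" "D u ?e q = 0" and Dd: "D G ?d q \<noteq> 0" if q: "q \<in> I \<times> J" for q
  proof -
    have qV: "q \<in> V" using q IJ by blast
    show G0: "D G ?e q = 0" using DG[OF qV] cs[OF q] by simp
    \<comment> \<open>Horizontality makes the x-derivative of k equal to G, which is also that of F
      G because F has x-derivative 1 and G has x-derivative 0.\<close>
    have "D F ?e q = 1" using DF[OF qV] cs[OF q] one by simp
    then show "D u ?e q = 0"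
      unfolding u_def using qV G0 hor[OF q]
      by (simp add: diff mult sm smF smG smooth_on_mult V) (simp add: G_def)
    show "D G ?d q \<noteq> 0" using DG[OF qV] trans[OF q] by simp
  qed
  define B W where "B t = G (x0, t)" and "W t = u (x0, t)" for t
  have rows: "G (x, t) = B t" "u (x, t) = W t" if "x \<in> I" "t \<in> J" for x t
    unfolding B_def W_def
    by (rule constant_along_rows[where V=V and I=I];
        use smG smu IJ that De in \<open>auto simp: D_def\<close>)+
  have "smooth_on J (\<lambda>t. (x0, t))" using IJ by (intro smooth_on_intros)
  then have smB: "smooth_on J B" and smW: "smooth_on J W"
    unfolding B_def W_def
    using smooth_on_compose[of J V "\<lambda>t. (x0, t)" G] smooth_on_compose[of J V "\<lambda>t. (x0, t)" u]
      IJ V smG smu by auto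
  have B': "(B has_field_derivative D G ?d (x0, t)) (at t)" if "t \<in> J" for t
    using DERIV_slices(2)[OF smG, of x0 t] IJ that unfolding B_def D_def by auto
  have Dd0: "D G ?d (x0, t) \<noteq> 0" if "t \<in> J" for t using Dd that IJ by simp
  have injB: "inj_on B J" by (rule injective_if_deriv_nonzero[OF IJ(5) B' Dd0])
  have nz: "deriv B t \<noteq> 0" if "t \<in> J" for t using DERIV_imp_deriv[OF B'] Dd0 that by simp
  have smg: "smooth_on (B ` J) (\<lambda>y. W (the_inv_into J B y))"
    by (rule smooth_on_compose_inverse[OF IJ(7) smB injB nz smW])
  have contB: "continuous_on J B" using smB by (rule smooth_on_continuous_on)
  have "open (B ` J)" using invariance_of_domain[OF contB IJ(7) injB] .
  then obtain \<rho> where \<rho>: "\<rho> > 0" "ball (B y0) \<rho> \<subseteq> B ` J"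
    using IJ(3) open_contains_ball by blast
  then have "smooth_on {B y0 - \<rho><..<B y0 + \<rho>} (\<lambda>y. W (the_inv_into J B y))"
    using smooth_on_subset[OF smg] by (simp add: ball_eq_greaterThanLessThan)
  from smooth_germ_extension[OF this, of "B y0"] \<rho>(1) obtain g \<epsilon> where
    g: "\<epsilon> > 0" "smooth_on UNIV g" "\<And>y. \<bar>y - B y0\<bar> < \<epsilon> \<Longrightarrow> g y = W (the_inv_into J B y)"
    by auto
  have "isCont B y0" using contB IJ by (simp add: continuous_on_eq_continuous_at)
  then obtain \<delta>' where \<delta>': "\<delta>' > 0" "\<And>t. dist t y0 < \<delta>' \<Longrightarrow> dist (B t) (B y0) < \<epsilon>"
    using g(1) unfolding continuous_at_eps_delta by metis
  \<comment> \<open>The strip is narrowed until B stays where the extended g agrees with W after the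
    inverse of B.\<close>
  define J' where "J' = {y0 - min \<delta>' r<..<y0 + min \<delta>' r}"
  have J': "J' \<subseteq> J" "open J'" "convex J'" "y0 \<in> J'" "\<And>t. t \<in> J' \<Longrightarrow> \<bar>B t - B y0\<bar> < \<epsilon>"
    using \<delta>' r(1) by (auto simp: J'_def J_def dist_real_def)
  let ?U = "X ` (I \<times> J')"
  have sub: "I \<times> J' \<subseteq> V" using IJ J' by blast
  have "?U \<subseteq> \<Sigma>"
    using sub sc openin_imp_subset by (fastforce simp: surface_chart_def)
  then have "surface_chart \<Sigma> (I \<times> J') X"
    using sub IJ J' by (intro surface_chart_subset[OF sc]) (auto intro: open_Times)
  then have "openin (top_of_set \<Sigma>) ?U" by (simp add: surface_chart_def)
  moreover have "connected ?U"
    by (intro connected_continuous_image continuous_on_subset[OF smooth_on_continuous_on[OF smX] sub]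
        convex_connected convex_Times IJ J')
  moreover have "p \<in> ?U" using q0 IJ J' by blast
  moreover have "planar_motion c s 0 0 ` ?U \<subseteq> graph (\<lambda>x y. x * y + g y)"
  proof (intro subsetI, elim imageE)
    fix w w' q assume q: "w = planar_motion c s 0 0 w'" "w' = X q" "q \<in> I \<times> J'"
    obtain x t where xt: "q = (x, t)" "x \<in> I" "t \<in> J'" using q(3) by blast
    have w: "w = (F q, G q, k q)" using q by (simp add: planar_motion_def F_def G_def f_def h_def k_def)
    have t: "t \<in> J" using xt J' by blast
    have "k q = F q * G q + W t" using rows(2)[OF xt(2) t] xt(1) by (simp add: u_def)
    also have "W t = g (B t)" using g(3)[OF J'(5)[OF xt(3)]] the_inv_into_f_f[OF injB t] by simp
    also have "B t = G q" using rows(1)[OF xt(2) t] xt(1) by simp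
    finally show "w \<in> graph (\<lambda>x y. x * y + g y)" using w by (auto simp: graph_def)
  qed
  ultimately show thesis using that[of c s ?U g] one g(2) by (simp add: power2_eq_square)
qed

section \<open>Surfaces carried into a graph by a rigid motion\<close>

text \<open>On the graph dz = y dx + x dy + g' dy, so dz + x dy - y dx restricts to (2 x + g') dy.
  An arbitrary differentiable map Z into the graph is allowed so that charts composed with a rigid
  motion are covered.\<close>

lemma contact_form_along_graph:
  assumes V: "open V" "q \<in> V" and Z: "(Z has_derivative D) (at q)" and g: "smooth_on UNIV g"
    and gr: "\<And>r. r \<in> V \<Longrightarrow> Z r \<in> graph (\<lambda>x y. x * y + g y)"
  shows "contact_form (Z q) (D v) = (2 * fst (Z q) + deriv g (fst (snd (Z q)))) * fst (snd (D v))"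
proof -
  have 1: "((\<lambda>r. fst (Z r)) has_derivative (\<lambda>v. fst (D v))) (at q)"
    and 2: "((\<lambda>r. fst (snd (Z r))) has_derivative (\<lambda>v. fst (snd (D v)))) (at q)"
    and 3: "((\<lambda>r. snd (snd (Z r))) has_derivative (\<lambda>v. snd (snd (D v)))) (at q)"
    by (intro has_derivative_fst has_derivative_snd Z)+
  have "(g has_derivative (*) (deriv g (fst (snd (Z q))))) (at (fst (snd (Z q))))"
    using smooth_on_DERIV[OF g UNIV_I] by (simp add: has_field_derivative_def)
  from has_derivative_compose[OF 2 this]
  have 4: "((\<lambda>r. g (fst (snd (Z r)))) has_derivative (\<lambda>v. deriv g (fst (snd (Z q))) * fst (snd (D v)))) (at q)" .
  have 5: "((\<lambda>r. fst (Z r) * fst (snd (Z r)) + g (fst (snd (Z r)))) has_derivative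
      (\<lambda>v. (fst (Z q) * fst (snd (D v)) + fst (D v) * fst (snd (Z q)))
        + deriv g (fst (snd (Z q))) * fst (snd (D v)))) (at q)"
    by (intro has_derivative_add has_derivative_mult 1 2 4)
  have "fst (Z r) * fst (snd (Z r)) + g (fst (snd (Z r))) = snd (snd (Z r))" if "r \<in> V" for r
    using gr[OF that] by (auto simp: graph_def)
  from has_derivative_transform_within_open[OF 5 V this]
  have "((\<lambda>r. snd (snd (Z r))) has_derivative
      (\<lambda>v. (fst (Z q) * fst (snd (D v)) + fst (D v) * fst (snd (Z q)))
        + deriv g (fst (snd (Z q))) * fst (snd (D v)))) (at q)" .
  from fun_cong[OF has_derivative_unique[OF 3 this], of v] show ?thesis
    by (simp add: contact_form_eq algebra_simps)
qed

lemma rigid_motion_chart_derivative: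
  assumes \<phi>: "rigid_motion \<phi>" and X: "(X has_derivative D) (at q)"
  obtains c s D' where "c\<^sup>2 + s\<^sup>2 = 1" "((\<lambda>r. \<phi> (X r)) has_derivative D') (at q)"
    "\<And>v. coframe (\<phi> (X q)) (D' v) =
      (c * fst (D v) - s * fst (snd (D v)), s * fst (D v) + c * fst (snd (D v)), contact_form (X q) (D v))"
proof -
  have sm: "smooth_on UNIV \<phi>" using \<phi> by (simp add: rigid_motion_def)
  note d = has_derivative_compose[OF X smooth_on_has_derivative[OF sm UNIV_I]]
  obtain c s where "c\<^sup>2 + s\<^sup>2 = 1" and "\<And>v. coframe (\<phi> (X q)) (frechet_derivative \<phi> (at (X q)) v) =
    (c * fst v - s * fst (snd v), s * fst v + c * fst (snd v), contact_form (X q) v)"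
    using rigid_motion_differential_coframe[OF \<phi>, of "X q"] by blast
  then show thesis using that[OF _ d] by blast
qed

text \<open>The contact form on the graph is 2 x + g' times dy, and this factor is nonzero because
  the form is positive on the second coordinate field. Hence the unit horizontal field e_1 is
  carried to plus or minus the first frame field; the other claims follow because rotations preserve
  inner products and areas of horizontal parts.\<close>

lemma compatible_chart_in_graph:
  assumes X: "compatible_chart \<Sigma> V X a b" and q: "q \<in> V" and \<phi>: "rigid_motion \<phi>"
    and g: "smooth_on UNIV g" and gr: "\<And>r. r \<in> V \<Longrightarrow> \<phi> (X r) \<in> graph (\<lambda>x y. x * y + g y)"
  defines "F \<equiv> \<lambda>r. fst (\<phi> (X r))" and "G \<equiv> \<lambda>r. fst (snd (\<phi> (X r)))"
  shows "2 * F q + deriv g (G q) \<noteq> 0"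
    and "(frechet_derivative F (at q) (1, 0))\<^sup>2 = 1"
    and "a q = 0 \<Longrightarrow> frechet_derivative F (at q) (0, 1) = 0"
    and "alpha X (partial_x X) q * (2 * F q + deriv g (G q)) = frechet_derivative F (at q) (1, 0)"
proof -
  have V: "open V" and smX: "smooth_on V X"
    using X by (auto simp: compatible_chart_def surface_chart_def)
  note dX = smooth_on_has_derivative[OF smX q]
  obtain c s D where cs: "c\<^sup>2 + s\<^sup>2 = 1" and D: "((\<lambda>r. \<phi> (X r)) has_derivative D) (at q)"
    and co: "\<And>v. coframe (\<phi> (X q)) (D v) = (c * fst (frechet_derivative X (at q) v)
        - s * fst (snd (frechet_derivative X (at q) v)),
      s * fst (frechet_derivative X (at q) v) + c * fst (snd (frechet_derivative X (at q) v)),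
      contact_form (X q) (frechet_derivative X (at q) v))"
    by (rule rigid_motion_chart_derivative[OF \<phi> dX]) (rule that)
  have cs': "c * c + s * s = 1" using cs by (simp add: power2_eq_square)
  let ?m = "2 * F q + deriv g (G q)" and ?E = "partial_x X q" and ?P = "partial_y X q"
  let ?\<alpha> = "alpha X (partial_x X) q"
  have F: "frechet_derivative F (at q) v = fst (D v)" for v
    using fun_cong[OF frechet_derivative_at[OF has_derivative_fst[OF D]], of v] by (simp add: F_def)
  have m: "contact_form (\<phi> (X q)) (D v) = ?m * fst (snd (D v))" for v
    unfolding F_def G_def by (rule contact_form_along_graph[OF V q D g gr])
  have C: "fst (D v) = c * fst (frechet_derivative X (at q) v) - s * fst (snd (frechet_derivative X (at q) v))"
      "fst (snd (D v)) = s * fst (frechet_derivative X (at q) v) + c * fst (snd (frechet_derivative X (at q) v))"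
      "?m * fst (snd (D v)) = contact_form (X q) (frechet_derivative X (at q) v)" for v
    using co[of v] unfolding m[symmetric] by (simp_all add: coframe_def)
  have De: "fst (D (1, 0)) = c * fst ?E - s * fst (snd ?E)"
      "fst (snd (D (1, 0))) = s * fst ?E + c * fst (snd ?E)"
      "?m * fst (snd (D (1, 0))) = contact_form (X q) ?E"
    and Dd: "fst (D (0, 1)) = c * fst ?P - s * fst (snd ?P)"
      "fst (snd (D (0, 1))) = s * fst ?P + c * fst (snd ?P)"
      "?m * fst (snd (D (0, 1))) = contact_form (X q) ?P"
    using C[of "(1, 0)"] C[of "(0, 1)"] by (auto simp only: partial_x_def partial_y_def)
  note fr = compatible_chart_frame[OF X q]
  show m0: "?m \<noteq> 0" using Dd(3) fr(3) by auto
  have y0: "s * fst ?E + c * fst (snd ?E) = 0" using De(2,3) fr(2) m0 by simp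
  have unit: "fst ?E * fst ?E + fst (snd ?E) * fst (snd ?E) = 1"
    using fr(1) by (simp add: power2_eq_square)
  have sq: "(c * fst ?E - s * fst (snd ?E)) * (c * fst ?E - s * fst (snd ?E)) = 1"
    using y0 unit cs' by algebra
  then show "(frechet_derivative F (at q) (1, 0))\<^sup>2 = 1" by (simp add: F De power2_eq_square)
  show "frechet_derivative F (at q) (0, 1) = 0" if "a q = 0"
  proof -
    have "b q > 0" using X q by (auto simp: compatible_chart_def)
    then have "fst ?E * fst ?P + fst (snd ?E) * fst (snd ?P) = 0" using fr(5) that by simp
    then have "c * fst ?P - s * fst (snd ?P) = 0" using y0 sq cs' by algebra
    then show ?thesis by (simp add: F Dd)
  qed
  \<comment> \<open>The area spanned by the horizontal parts of the two coordinate fields is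
    \<alpha> times \<open>contact_form (X q) ?P\<close> in the chart, and the product of the
    x-derivative of F and the y-derivative of G in the graph.\<close>
  have "contact_form (X q) ?P * (?\<alpha> * ?m - fst (D (1, 0))) = 0"
    using fr(4) Dd(2,3) De(1) y0 cs' unit by algebra
  then show "?\<alpha> * ?m = frechet_derivative F (at q) (1, 0)" using fr(3) by (simp add: F)
qed

text \<open>In normal coordinates F = \<sigma> x + A with a fixed sign \<sigma>, so the formula for
  \<alpha> reads 2 F + g' = \<sigma> (2 x + \<zeta>), and g' = \<sigma> \<zeta> - 2 A is constant
  together with \<zeta>.\<close>

lemma symmetric_chart_in_graph:
  assumes X: "normal_chart \<Sigma> V X \<zeta>" and \<zeta>: "\<zeta> constant_on (snd ` V)" and q: "q \<in> V"
    and \<phi>: "rigid_motion \<phi>" and g: "smooth_on UNIV g"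
    and gr: "\<And>r. r \<in> V \<Longrightarrow> \<phi> (X r) \<in> graph (\<lambda>x y. x * y + g y)"
  obtains T where "openin (top_of_set \<Sigma>) T" "X q \<in> T"
    "\<And>w. w \<in> T \<Longrightarrow> deriv g (fst (snd (\<phi> w))) = deriv g (fst (snd (\<phi> (X q))))"
proof -
  define F G where "F r = fst (\<phi> (X r))" and "G r = fst (snd (\<phi> (X r)))" for r
  note cc = X[unfolded normal_chart_def, THEN conjunct1]
    and al = X[unfolded normal_chart_def, THEN conjunct2]
  have sc: "surface_chart \<Sigma> V X" using cc by (simp add: compatible_chart_def)
  then have V: "open V" and smX: "smooth_on V X" by (auto simp: surface_chart_def)
  have sm\<phi>: "smooth_on UNIV \<phi>" using \<phi> by (simp add: rigid_motion_def)
  have smF: "smooth_on V F"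
    unfolding F_def by (intro smooth_on_fst V smooth_on_compose[OF V open_UNIV _ sm\<phi> smX]) auto
  note ch = compatible_chart_in_graph[OF cc _ \<phi> g gr, folded F_def G_def]
  obtain x0 y0 where q0: "q = (x0, y0)" by fastforce
  obtain r where r: "r > 0" "{x0 - r<..<x0 + r} \<times> {y0 - r<..<y0 + r} \<subseteq> V"
    using open_contains_square[OF V] q q0 by metis
  define Q where "Q = {x0 - r<..<x0 + r} \<times> {y0 - r<..<y0 + r}"
  have Q: "Q \<subseteq> V" "open Q" "convex Q" "q \<in> Q"
    using r q0 by (auto simp: Q_def intro: open_Times convex_Times)
  \<comment> \<open>A continuous function with values \<plusminus> 1 on the connected square is
    constant, which yields the sign \<sigma>.\<close>
  have vals: "frechet_derivative F (at r) (1, 0) \<in> {-1, 1}" if "r \<in> Q" for r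
    using ch(2)[of r] Q that by (auto simp: power2_eq_1_iff)
  have "finite ((\<lambda>r. frechet_derivative F (at r) (1, 0)) ` Q)"
    by (rule finite_subset[of _ "{-1, 1}"]) (use vals in auto)
  moreover have "continuous_on Q (\<lambda>r. frechet_derivative F (at r) (1, 0))"
    by (rule continuous_on_subset[OF smooth_on_continuous_on[OF smooth_on_frechet_derivative[OF smF]] Q(1)])
  ultimately obtain \<sigma> where \<sigma>: "\<And>r. r \<in> Q \<Longrightarrow> frechet_derivative F (at r) (1, 0) = \<sigma>"
    using continuous_finite_range_constant[OF convex_connected[OF Q(3)]] unfolding constant_on_def by metis
  have "\<exists>A. \<forall>r\<in>Q. F r - \<sigma> * fst r = A"
  proof (rule has_derivative_zero_constant[OF Q(3)])
    fix r assume r: "r \<in> Q"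
    then have rV: "r \<in> V" using Q by blast
    note dF = smooth_on_has_derivative[OF smF rV]
    have "frechet_derivative F (at r) v = \<sigma> * fst v" for v
    proof -
      have "frechet_derivative F (at r) v = frechet_derivative F (at r) (fst v *\<^sub>R (1, 0) + snd v *\<^sub>R (0, 1))"
        by simp
      also have "\<dots> = fst v * frechet_derivative F (at r) (1, 0) + snd v * frechet_derivative F (at r) (0, 1)"
        by (simp only: has_derivative_linear[OF dF, THEN linear_add]
            has_derivative_linear[OF dF, THEN linear_scale] real_scaleR_def)
      finally show ?thesis using ch(3)[OF rV] \<sigma>[OF r] by simp
    qed
    then have "(F has_derivative (\<lambda>v. \<sigma> * fst v)) (at r)" using dF by presburger
    then have "((\<lambda>r. F r - \<sigma> * fst r) has_derivative (\<lambda>v. \<sigma> * fst v - \<sigma> * fst v)) (at r)"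
      by (intro has_derivative_diff has_derivative_mult_right has_derivative_fst has_derivative_ident)
    then show "((\<lambda>r. F r - \<sigma> * fst r) has_derivative (\<lambda>h. 0)) (at r within Q)"
      using has_derivative_at_withinI by force
  qed
  then obtain A where "\<forall>r\<in>Q. F r - \<sigma> * fst r = A" ..
  then have A: "F r = \<sigma> * fst r + A" if "r \<in> Q" for r using that by (simp add: diff_eq_eq add.commute)
  obtain z where z: "\<And>y. y \<in> snd ` V \<Longrightarrow> \<zeta> y = z" using \<zeta> unfolding constant_on_def by blast
  have const: "deriv g (G r) = \<sigma> * z - 2 * A" if r: "r \<in> Q" for r
  proof -
    have rV: "r \<in> V" using Q r by blast
    have nz: "2 * fst r + z \<noteq> 0" and "alpha X (partial_x X) r = 1 / (2 * fst r + z)"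
      using al rV z[of "snd r"] by (auto simp: alpha_type_II_def)
    then have "1 / (2 * fst r + z) * (2 * F r + deriv g (G r)) = \<sigma>"
      using ch(4)[OF rV] \<sigma>[OF r] by simp
    then have "2 * F r + deriv g (G r) = \<sigma> * (2 * fst r + z)"
      using nz by (simp add: divide_eq_eq)
    then show ?thesis using A[OF r] by (simp add: algebra_simps)
  qed
  have "X ` Q \<subseteq> \<Sigma>" using Q(1) sc openin_imp_subset by (fastforce simp: surface_chart_def)
  then have "surface_chart \<Sigma> Q X" using Q by (intro surface_chart_subset[OF sc]) auto
  then have "openin (top_of_set \<Sigma>) (X ` Q)" by (simp add: surface_chart_def)
  moreover have "X q \<in> X ` Q" using Q by blast
  moreover have "deriv g (fst (snd (\<phi> w))) = deriv g (fst (snd (\<phi> (X q))))" if "w \<in> X ` Q" for w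
  proof -
    from that obtain r where "w = X r" "r \<in> Q" by blast
    then show ?thesis using const[of r] const[OF Q(4)] by (simp add: G_def)
  qed
  ultimately show thesis by (rule that)
qed

text \<open>The constant found in a normal chart depends on that chart, so only local constancy
  carries over; connectedness does the rest.\<close>

lemma symmetric_type_II_imp_deriv_constant:
  assumes \<Sigma>: "symmetric_type_II \<Sigma>" "connected \<Sigma>" and \<phi>: "rigid_motion \<phi>"
    and g: "smooth_on UNIV g" and gr: "\<phi> ` \<Sigma> \<subseteq> graph (\<lambda>x y. x * y + g y)"
  shows "\<exists>c. \<forall>(x, y, z)\<in>\<phi> ` \<Sigma>. deriv g y = c"
proof -
  have "(\<lambda>w. deriv g (fst (snd (\<phi> w)))) constant_on \<Sigma>"
  proof (rule locally_constant_imp_constant[OF \<Sigma>(2)])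
    fix p assume p: "p \<in> \<Sigma>"
    then obtain V X \<zeta> where X: "normal_chart \<Sigma> V X \<zeta>" "p \<in> X ` V" "\<zeta> constant_on (snd ` V)"
      using \<Sigma>(1) unfolding symmetric_type_II_def by blast
    then obtain q where q: "q \<in> V" "p = X q" by blast
    have "openin (top_of_set \<Sigma>) (X ` V)"
      using X(1) by (simp add: normal_chart_def compatible_chart_def surface_chart_def)
    then have "\<phi> (X r) \<in> graph (\<lambda>x y. x * y + g y)" if "r \<in> V" for r
      using gr openin_imp_subset that by blast
    from symmetric_chart_in_graph[OF X(1,3) q(1) \<phi> g this] q(2)
    show "\<exists>T. openin (top_of_set \<Sigma>) T \<and> p \<in> T \<and>
        (\<forall>x\<in>T. deriv g (fst (snd (\<phi> x))) = deriv g (fst (snd (\<phi> p))))" by metis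
  qed
  then show ?thesis unfolding constant_on_def by fastforce
qed

text \<open>
  The assumptions say that the chart has
  \<open>\<partial>\<^sub>x = e\<^sub>1\<close> and \<open>\<partial>\<^sub>y = \<sigma> (e\<^sub>2 + (2 x + z) T)\<close>. The sign \<open>\<sigma>\<close> of \<open>\<alpha>\<close> is needed because
  normal coordinates require \<open>b > 0\<close>.
\<close>

lemma normal_chart_constantI:
  assumes sc: "surface_chart \<Sigma> V X" and \<sigma>: "\<sigma> = 1 \<or> \<sigma> = -1"
    and pos: "\<And>q. q \<in> V \<Longrightarrow> \<sigma> * (2 * fst q + z) > 0"
    and co: "\<And>q. q \<in> V \<Longrightarrow> \<exists>c s. c\<^sup>2 + s\<^sup>2 = 1 \<and> (\<forall>v. coframe (X q) (frechet_derivative X (at q) v) =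
      (c * fst v + s * (\<sigma> * snd v), c * (\<sigma> * snd v) - s * fst v, \<sigma> * (2 * fst q + z) * snd v))"
  shows "normal_chart \<Sigma> V X (\<lambda>y. z)"
proof -
  have V: "open V" and smX: "smooth_on V X" using sc by (auto simp: surface_chart_def)
  have \<sigma>2: "\<sigma> * \<sigma> = 1" using \<sigma> by auto
  let ?E = "partial_x X" and ?P = "partial_y X"
  have main: "\<not> singular_at X q \<and> ?E q \<in> tangent_plane X q \<inter> contact_plane (X q) \<and>
      adapted_metric (X q) (?E q) (?E q) = 1 \<and> alpha X ?E q = 1 / (2 * fst q + z) \<and>
      e2_hat X ?E q = (\<bar>alpha X ?E q\<bar> / sqrt (1 + (alpha X ?E q)\<^sup>2)) *\<^sub>R ?P q" if q: "q \<in> V" for q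
  proof -
    define \<mu> where "\<mu> = \<sigma> * (2 * fst q + z)"
    obtain c s where cs: "c\<^sup>2 + s\<^sup>2 = 1" and
      "\<And>v. coframe (X q) (frechet_derivative X (at q) v) =
        (c * fst v + s * (\<sigma> * snd v), c * (\<sigma> * snd v) - s * fst v, \<mu> * snd v)"
      using co[OF q] unfolding \<mu>_def by blast
    note co = this(2)
    have cs': "c * c + s * s = 1" using cs by (simp add: power2_eq_square)
    have \<mu>: "\<mu> > 0" using pos[OF q] by (simp add: \<mu>_def)
    have m: "2 * fst q + z = \<sigma> * \<mu>" using \<sigma>2 by (simp add: \<mu>_def)
    have E: "fst (?E q) = c" "fst (snd (?E q)) = - s" "contact_form (X q) (?E q) = 0"
      and P: "contact_form (X q) (?P q) = \<mu>"
      using co[of "(1, 0)"] co[of "(0, 1)"] by (simp_all add: partial_x_def partial_y_def coframe_def)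
    have coP: "coframe (X q) (?P q) = (s * \<sigma>, c * \<sigma>, \<mu>)"
      using co[of "(0, 1)"] by (simp add: partial_y_def)
    have lin: "linear (coframe (X q))" by (rule linear_coframe)
    have "?P q \<in> tangent_plane X q" by (simp add: tangent_plane_def partial_y_def)
    then have "\<not> singular_at X q" using P \<mu> by (auto simp: singular_at_def contact_plane_def)
    moreover have "?E q \<in> tangent_plane X q \<inter> contact_plane (X q)"
      using E by (simp add: tangent_plane_def contact_plane_def partial_x_def)
    moreover have "adapted_metric (X q) (?E q) (?E q) = 1"
      using E cs by (simp add: adapted_metric_eq)
    moreover have coE2: "coframe (X q) (a *\<^sub>R cplx (X q) (?E q) + reeb (X q)) = (a * s, a * c, 1)" for a
      using E by (simp add: linear_add[OF lin] linear_scale[OF lin] coframe_cplx coframe_reeb)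
    have al: "alpha X ?E q = \<sigma> / \<mu>"
      unfolding alpha_def
    proof (rule the_equality)
      \<comment> \<open>The parameter direction is scaled so that its image has contact component 1,
        as \<alpha> J e_1 + T has.\<close>
      have "coframe (X q) (frechet_derivative X (at q) (0, 1 / \<mu>)) =
          coframe (X q) ((\<sigma> / \<mu>) *\<^sub>R cplx (X q) (?E q) + reeb (X q))"
        unfolding co coE2 using \<mu> by simp
      then have "frechet_derivative X (at q) (0, 1 / \<mu>) = (\<sigma> / \<mu>) *\<^sub>R cplx (X q) (?E q) + reeb (X q)"
        by (simp only: coframe_eq_iff)
      then show "(\<sigma> / \<mu>) *\<^sub>R cplx (X q) (?E q) + reeb (X q) \<in> tangent_plane X q"
        unfolding tangent_plane_def by (metis rangeI)
    next
      fix a assume "a *\<^sub>R cplx (X q) (?E q) + reeb (X q) \<in> tangent_plane X q"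
      then obtain v where "a *\<^sub>R cplx (X q) (?E q) + reeb (X q) = frechet_derivative X (at q) v"
        unfolding tangent_plane_def by blast
      from arg_cong[OF this, of "coframe (X q)", unfolded co coE2]
      have "a * s = c * fst v + s * (\<sigma> * snd v)" "a * c = c * (\<sigma> * snd v) - s * fst v" "\<mu> * snd v = 1"
        by simp_all
      then have "a * \<mu> = \<sigma>" using cs' by algebra
      then show "a = \<sigma> / \<mu>" using \<mu> by (simp add: field_simps)
    qed
    moreover have "\<sigma> / \<mu> = 1 / (2 * fst q + z)" using m \<sigma> by auto
    moreover have "e2_hat X ?E q = (\<bar>alpha X ?E q\<bar> / sqrt (1 + (alpha X ?E q)\<^sup>2)) *\<^sub>R ?P q"
    proof -
      \<comment> \<open>Here the sign put into the second coordinate field pays off: \<alpha> J e_1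
        + T is the positive multiple |\<alpha>| of it.\<close>
      have "coframe (X q) (\<bar>\<sigma> / \<mu>\<bar> *\<^sub>R ?P q) = (\<sigma> / \<mu> * s, \<sigma> / \<mu> * c, 1)"
        using \<mu> \<sigma> by (auto simp: linear_scale[OF lin] coP)
      then have "coframe (X q) (\<bar>\<sigma> / \<mu>\<bar> *\<^sub>R ?P q) =
          coframe (X q) ((\<sigma> / \<mu>) *\<^sub>R cplx (X q) (?E q) + reeb (X q))"
        by (simp only: coE2)
      then have eq: "(\<sigma> / \<mu>) *\<^sub>R cplx (X q) (?E q) + reeb (X q) = \<bar>\<sigma> / \<mu>\<bar> *\<^sub>R ?P q"
        by (simp only: coframe_eq_iff)
      show ?thesis unfolding e2_hat_def al eq scaleR_scaleR by (simp only: times_divide_eq_left mult_1)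
    qed
    ultimately show ?thesis using al by simp
  qed
  have "smooth_on V ?E"
    unfolding partial_x_def by (rule smooth_on_frechet_derivative[OF smX])
  then have "characteristic_field V X ?E"
    unfolding characteristic_field_def using main by simp
  moreover have nz: "2 * fst q + z \<noteq> 0" if "q \<in> V" for q using pos[OF that] by auto
  moreover have "0 < \<bar>alpha X ?E q\<bar> / sqrt (1 + (alpha X ?E q)\<^sup>2)" if "q \<in> V" for q
  proof (rule divide_pos_pos)
    show "0 < \<bar>alpha X ?E q\<bar>" using main[OF that] nz[OF that] by simp
    show "0 < sqrt (1 + (alpha X ?E q)\<^sup>2)" by (rule real_sqrt_gt_zero) (rule add_pos_nonneg; simp)
  qed
  ultimately have "compatible_chart \<Sigma> V X (\<lambda>q. 0) (\<lambda>q. \<bar>alpha X ?E q\<bar> / sqrt (1 + (alpha X ?E q)\<^sup>2))"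
    unfolding compatible_chart_def using sc main by simp
  moreover have "alpha_type_II V X (\<lambda>y. z)"
    unfolding alpha_type_II_def using main nz by (fastforce intro: smooth_on_const)
  ultimately show ?thesis by (simp add: normal_chart_def)
qed

section \<open>Normal coordinates where g' is constant\<close>

lemma graph_iff: "w \<in> graph u \<longleftrightarrow> snd (snd w) = u (fst w) (fst (snd w))"
  by (cases w) (auto simp: graph_def)

text \<open>The coordinates x and y of the graph are themselves normal, once y is reversed where 2 x
  + z < 0 so that the contact form becomes positive on the second coordinate field.\<close>

lemma deriv_constant_imp_normal_chart:
  assumes \<Sigma>: "special_type_II \<Sigma>" and \<phi>: "rigid_motion \<phi>" and g: "smooth_on UNIV g"
    and gr: "\<phi> ` \<Sigma> \<subseteq> graph (\<lambda>x y. x * y + g y)"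
    and const: "\<And>w. w \<in> \<Sigma> \<Longrightarrow> deriv g (fst (snd (\<phi> w))) = z" and p: "p \<in> \<Sigma>"
  obtains V X where "normal_chart \<Sigma> V X (\<lambda>y. z)" "p \<in> X ` V"
proof -
  define \<psi> where "\<psi> = inv \<phi>"
  have bij: "bij \<phi>" and sm: "smooth_on UNIV \<phi>" "smooth_on UNIV \<psi>"
    using \<phi> by (auto simp: rigid_motion_def \<psi>_def)
  have inv: "\<phi> (\<psi> w) = w" "\<psi> (\<phi> w) = w" for w
    using bij by (simp_all add: \<psi>_def bij_is_surj surj_f_inv_f bij_is_inj)
  define \<Gamma> :: "real \<times> real \<Rightarrow> heis" where "\<Gamma> w = (fst w, snd w, fst w * snd w + g (snd w))" for w
  define \<pi> :: "heis \<Rightarrow> real \<times> real" where "\<pi> w = (fst w, fst (snd w))" for w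
  have \<Gamma>\<pi>: "\<Gamma> (\<pi> (\<phi> w)) = \<phi> w" if "w \<in> \<Sigma>" for w
  proof -
    have "\<phi> w \<in> graph (\<lambda>x y. x * y + g y)" using gr that by blast
    then show ?thesis by (auto simp: graph_def \<Gamma>_def \<pi>_def)
  qed
  have \<pi>\<Gamma>: "\<pi> (\<Gamma> w) = w" for w by (simp add: \<Gamma>_def \<pi>_def)
  define W where "W = \<pi> ` \<phi> ` \<Sigma>"
  have chart: thesis
    if w: "w \<in> \<Sigma>" and th: "\<And>V X a b q. compatible_chart \<Sigma> V X a b \<Longrightarrow> w = X q \<Longrightarrow> q \<in> V \<Longrightarrow> X ` V \<subseteq> \<Sigma> \<Longrightarrow> thesis"
    for w thesis
  proof -
    obtain V X a b c where X: "compatible_chart \<Sigma> V X a b" "w \<in> X ` V"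
      by (rule special_type_II_chart[OF \<Sigma> w])
    have "X ` V \<subseteq> \<Sigma>"
      using X(1) openin_imp_subset by (fastforce simp: compatible_chart_def surface_chart_def)
    with th[OF X(1)] X(2) show thesis by blast
  qed
  \<comment> \<open>Where this factor vanishes the graph is tangent to the contact plane; compatible
    charts exclude that.\<close>
  have nz: "2 * fst (\<phi> w) + z \<noteq> 0" if w: "w \<in> \<Sigma>" for w
  proof (rule chart[OF w])
    fix V X a b q assume X: "compatible_chart \<Sigma> V X a b" "w = X q" "q \<in> V" "X ` V \<subseteq> \<Sigma>"
    then have "\<phi> (X r) \<in> graph (\<lambda>x y. x * y + g y)" if "r \<in> V" for r
      using gr that by blast
    from compatible_chart_in_graph(1)[OF X(1,3) \<phi> g this] show ?thesis
      using const[OF w] X(2) by simp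
  qed
  \<comment> \<open>Charts followed by the rigid motion and the projection are continuous injections
    between planes, since a point of the graph is determined by its projection; invariance of domain
    applies.\<close>
  have openW: "open W"
    unfolding open_subopen[of W]
  proof
    fix w assume "w \<in> W"
    then obtain p' where p': "p' \<in> \<Sigma>" "w = \<pi> (\<phi> p')" by (auto simp: W_def)
    show "\<exists>T. open T \<and> w \<in> T \<and> T \<subseteq> W"
    proof (rule chart[OF p'(1)])
      fix V X a b q assume X: "compatible_chart \<Sigma> V X a b" "p' = X q" "q \<in> V" "X ` V \<subseteq> \<Sigma>"
      let ?h = "\<lambda>r. \<pi> (\<phi> (X r))"
      from X(1) obtain Y where V: "open V" and smX: "smooth_on V X" and Y: "homeomorphism V (X ` V) X Y"
        by (auto simp: compatible_chart_def surface_chart_def)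
      have "smooth_on V ?h"
        unfolding \<pi>_def using V smooth_on_compose[OF V open_UNIV _ sm(1) smX]
        by (intro smooth_on_intros) auto
      then have "continuous_on V ?h" by (rule smooth_on_continuous_on)
      moreover have "inj_on ?h V"
      proof (rule inj_onI)
        fix r r' assume r: "r \<in> V" "r' \<in> V" and "?h r = ?h r'"
        then have "\<phi> (X r) = \<phi> (X r')" using \<Gamma>\<pi> X(4) by (metis image_subset_iff)
        then have "X r = X r'" by (metis inv(2))
        then show "r = r'" using Y r by (metis homeomorphism_apply1)
      qed
      ultimately have "open (?h ` V)" using V by (intro invariance_of_domain)
      then show ?thesis using X p' by (intro exI[of _ "?h ` V"]) (auto simp: W_def)
    qed
  qed
  define \<sigma> where "\<sigma> = sgn (2 * fst (\<phi> p) + z)"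
  have \<sigma>: "\<sigma> = 1 \<or> \<sigma> = -1" using nz[OF p] by (auto simp: \<sigma>_def sgn_if)
  have \<sigma>2: "\<sigma> * (\<sigma> * x) = x" for x using \<sigma> by auto
  \<comment> \<open>\<sigma> is the sign at p only, so the domain is cut down to the side on which
    the factor keeps that sign.\<close>
  define V where "V = {q. (fst q, \<sigma> * snd q) \<in> W \<and> \<sigma> * (2 * fst q + z) > 0}"
  define X where "X q = \<psi> (\<Gamma> (fst q, \<sigma> * snd q))" for q
  have \<phi>X: "\<phi> (X q) = (fst q, \<sigma> * snd q, fst q * (\<sigma> * snd q) + g (\<sigma> * snd q))" for q
    by (simp add: X_def inv \<Gamma>_def)
  have X\<Sigma>: "X q \<in> \<Sigma>" if "(fst q, \<sigma> * snd q) \<in> W" for q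
  proof -
    from that obtain w where w: "w \<in> \<Sigma>" "(fst q, \<sigma> * snd q) = \<pi> (\<phi> w)"
      unfolding W_def by blast
    then have "X q = w" by (simp add: X_def w(2) \<Gamma>\<pi> inv)
    then show ?thesis using w by simp
  qed
  define Y where "Y w = (fst (\<phi> w), \<sigma> * fst (snd (\<phi> w)))" for w
  have YX: "Y (X q) = q" for q by (simp add: Y_def \<phi>X \<sigma>2)
  have XY: "X (Y w) = w" if "w \<in> \<Sigma>" for w
    using \<Gamma>\<pi>[OF that] by (simp add: X_def Y_def \<sigma>2 \<pi>_def inv)
  have openV: "open V"
  proof -
    have "open ((\<lambda>q. (fst q, \<sigma> * snd q)) -` W)"
      by (rule open_vimage[OF openW]) (intro continuous_intros)
    moreover have "open {q. \<sigma> * (2 * fst q + z) > (0::real)}"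
      for z by (rule open_Collect_less) (intro continuous_intros)+
    ultimately show ?thesis
      unfolding V_def vimage_def by (rule open_Collect_conj)
  qed
  have img: "X ` V = \<Sigma> \<inter> \<phi> -` {w. \<sigma> * (2 * fst w + z) > 0}"
  proof (intro equalityI subsetI)
    fix w assume "w \<in> X ` V"
    then show "w \<in> \<Sigma> \<inter> \<phi> -` {w. \<sigma> * (2 * fst w + z) > 0}"
      using X\<Sigma> by (auto simp: V_def \<phi>X)
  next
    fix w assume w: "w \<in> \<Sigma> \<inter> \<phi> -` {w. \<sigma> * (2 * fst w + z) > 0}"
    then have "Y w \<in> V" by (auto simp: V_def Y_def \<sigma>2 W_def \<pi>_def)
    then show "w \<in> X ` V" using XY w by (metis IntD1 image_eqI)
  qed
  have smG: "smooth_on UNIV (\<lambda>q. g (\<sigma> * snd q))"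
    by (rule smooth_on_compose[OF open_UNIV open_UNIV _ g]) (auto intro!: smooth_on_intros)
  have sm\<Gamma>: "smooth_on UNIV (\<lambda>q. \<Gamma> (fst q, \<sigma> * snd q))"
    unfolding \<Gamma>_def fst_conv snd_conv by (intro smooth_on_intros smG open_UNIV)
  have smX: "smooth_on UNIV X"
    unfolding X_def by (rule smooth_on_compose[OF open_UNIV open_UNIV _ sm(2) sm\<Gamma>]) auto
  have smY: "smooth_on UNIV Y"
    unfolding Y_def by (intro smooth_on_intros sm open_UNIV)
  have co: "\<exists>c s. c\<^sup>2 + s\<^sup>2 = 1 \<and> (\<forall>v. coframe (X q) (frechet_derivative X (at q) v) =
      (c * fst v + s * (\<sigma> * snd v), c * (\<sigma> * snd v) - s * fst v, \<sigma> * (2 * fst q + z) * snd v))"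
    if q: "q \<in> V" for q
  proof -
    let ?D = "frechet_derivative X (at q)"
    obtain c s D' where cs: "c\<^sup>2 + s\<^sup>2 = 1" and D': "((\<lambda>r. \<phi> (X r)) has_derivative D') (at q)"
      and co: "\<And>v. coframe (\<phi> (X q)) (D' v) = (c * fst (?D v) - s * fst (snd (?D v)),
        s * fst (?D v) + c * fst (snd (?D v)), contact_form (X q) (?D v))"
      by (rule rigid_motion_chart_derivative[OF \<phi> smooth_on_has_derivative[OF smX UNIV_I]]) (rule that)
    have "((\<lambda>r. fst (\<phi> (X r))) has_derivative (\<lambda>v. fst v)) (at q)"
      and "((\<lambda>r. fst (snd (\<phi> (X r)))) has_derivative (\<lambda>v. \<sigma> * snd v)) (at q)"
      unfolding \<phi>X by (auto intro!: derivative_eq_intros)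
    from has_derivative_unique[OF has_derivative_fst[OF D'] this(1)]
      has_derivative_unique[OF has_derivative_fst[OF has_derivative_snd[OF D']] this(2)]
    have D1: "fst (D' v) = fst v" and D2: "fst (snd (D' v)) = \<sigma> * snd v" for v
      by metis+
    have "X q \<in> \<Sigma>" using X\<Sigma> q by (simp add: V_def)
    then have dz: "deriv g (\<sigma> * snd q) = z" using const by (fastforce simp: \<phi>X)
    have D3: "contact_form (\<phi> (X q)) (D' v) = (2 * fst q + z) * (\<sigma> * snd v)" for v
      using contact_form_along_graph[OF open_UNIV UNIV_I D' g, of v] dz
      by (simp add: \<phi>X graph_def D2)
    have "fst (?D v) = c * fst v + s * (\<sigma> * snd v)" "fst (snd (?D v)) = c * (\<sigma> * snd v) - s * fst v"
      "contact_form (X q) (?D v) = \<sigma> * (2 * fst q + z) * snd v" for v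
    proof -
      have e: "fst v = c * fst (?D v) - s * fst (snd (?D v))" "\<sigma> * snd v = s * fst (?D v) + c * fst (snd (?D v))"
        and e3: "(2 * fst q + z) * (\<sigma> * snd v) = contact_form (X q) (?D v)"
        using co[of v] unfolding coframe_def D1 D2 D3 prod.inject by iprover+
      show "contact_form (X q) (?D v) = \<sigma> * (2 * fst q + z) * snd v"
        using e3 by (simp only: ac_simps)
      have "c * c + s * s = 1" using cs by (simp add: power2_eq_square)
      with e show "fst (?D v) = c * fst v + s * (\<sigma> * snd v)" "fst (snd (?D v)) = c * (\<sigma> * snd v) - s * fst v"
        by algebra+
    qed
    then show ?thesis using cs by (intro exI[of _ c] exI[of _ s]) (simp add: coframe_def)
  qed
  have inj: "inj (frechet_derivative X (at q))" if q: "q \<in> V" for q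
  proof (rule injI)
    fix v v' assume eq: "frechet_derivative X (at q) v = frechet_derivative X (at q) v'"
    obtain c s where cs: "c\<^sup>2 + s\<^sup>2 = 1" and co': "\<And>v. coframe (X q) (frechet_derivative X (at q) v) =
      (c * fst v + s * (\<sigma> * snd v), c * (\<sigma> * snd v) - s * fst v, \<sigma> * (2 * fst q + z) * snd v)"
      using co[OF q] by blast
    have "\<sigma> * (2 * fst q + z) > 0" using q by (simp add: V_def)
    then have "\<sigma> * (2 * fst q + z) \<noteq> 0" by (rule less_imp_neq[symmetric])
    moreover have "(c * fst v + s * (\<sigma> * snd v), c * (\<sigma> * snd v) - s * fst v, \<sigma> * (2 * fst q + z) * snd v)
      = (c * fst v' + s * (\<sigma> * snd v'), c * (\<sigma> * snd v') - s * fst v', \<sigma> * (2 * fst q + z) * snd v')"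
      unfolding co'[symmetric] eq ..
    ultimately have 2: "snd v = snd v'" and 1: "c * fst v = c * fst v'" "s * fst v = s * fst v'" by auto
    have "c * c + s * s = 1" using cs by (simp add: power2_eq_square)
    with 1 have "fst v = fst v'" by algebra
    with 2 show "v = v'" by (simp add: prod_eq_iff)
  qed
  have "surface_chart \<Sigma> V X"
    unfolding surface_chart_def
  proof (intro conjI exI ballI inj openV smooth_on_subset[OF smX subset_UNIV])
    have "open {w :: heis. \<sigma> * (2 * fst w + z) > 0}"
      by (rule open_Collect_less) (intro continuous_intros)+
    then show "openin (top_of_set \<Sigma>) (X ` V)"
      unfolding img by (rule continuous_openin_preimage_gen[rotated])
        (rule continuous_on_subset[OF smooth_on_continuous_on[OF sm(1)] subset_UNIV])
    show "homeomorphism V (X ` V) X Y"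
      by (rule homeomorphismI)
        (auto simp: YX intro: continuous_on_subset[OF smooth_on_continuous_on[OF smX] subset_UNIV]
          continuous_on_subset[OF smooth_on_continuous_on[OF smY] subset_UNIV])
  qed
  from normal_chart_constantI[OF this \<sigma> _ co] have "normal_chart \<Sigma> V X (\<lambda>y. z)"
    by (simp add: V_def)
  moreover have "\<sigma> * (2 * fst (\<phi> p) + z) > 0" using nz[OF p] by (simp add: \<sigma>_def sgn_if)
  then have "p \<in> X ` V" unfolding img using p by simp
  ultimately show thesis by (rule that)
qed

lemma symmetric_type_II_iff_deriv_constant:
  assumes "special_type_II \<Sigma>" "connected \<Sigma>" "rigid_motion \<phi>" "smooth_on UNIV g"
    "\<phi> ` \<Sigma> \<subseteq> graph (\<lambda>x y. x * y + g y)"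
  shows "symmetric_type_II \<Sigma> \<longleftrightarrow> (\<exists>c. \<forall>(x, y, z)\<in>\<phi> ` \<Sigma>. deriv g y = c)"
proof
  assume "\<exists>c. \<forall>(x, y, z)\<in>\<phi> ` \<Sigma>. deriv g y = c"
  then obtain c where c: "\<And>w. w \<in> \<Sigma> \<Longrightarrow> deriv g (fst (snd (\<phi> w))) = c" by fastforce
  have "\<exists>V X \<zeta>. normal_chart \<Sigma> V X \<zeta> \<and> p \<in> X ` V \<and> \<zeta> constant_on (snd ` V)" if p: "p \<in> \<Sigma>" for p
  proof -
    obtain V X where "normal_chart \<Sigma> V X (\<lambda>y. c)" "p \<in> X ` V"
      by (rule deriv_constant_imp_normal_chart[OF assms(1,3,4,5) c p])
    moreover have "(\<lambda>y. c) constant_on (snd ` V)" by (auto simp: constant_on_def)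
    ultimately show ?thesis by blast
  qed
  then show "symmetric_type_II \<Sigma>" using assms(1) by (simp add: symmetric_type_II_def)
qed (rule symmetric_type_II_imp_deriv_constant[OF _ assms(2-5)])

text \<open>A constant slope of g over U says nothing about the slope of the chosen extension
  elsewhere. If U is symmetric, g is affine on the y-range of the rotated piece and can be exchanged
  for that affine function without moving the piece off the graph.\<close>

lemma special_type_II_local_graph_adapted:
  assumes \<Sigma>: "special_type_II \<Sigma>" and p: "p \<in> \<Sigma>"
  obtains c s U g where "c\<^sup>2 + s\<^sup>2 = 1" "openin (top_of_set \<Sigma>) U" "p \<in> U" "connected U"
    "smooth_on UNIV g" "planar_motion c s 0 0 ` U \<subseteq> graph (\<lambda>x y. x * y + g y)"
    "symmetric_type_II U \<longrightarrow> (\<exists>k d. g = (\<lambda>y. k * y + d))"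
proof -
  obtain c s U g where cs: "c\<^sup>2 + s\<^sup>2 = 1" and U: "openin (top_of_set \<Sigma>) U" "p \<in> U" "connected U"
    and g: "smooth_on UNIV g" and gr: "planar_motion c s 0 0 ` U \<subseteq> graph (\<lambda>x y. x * y + g y)"
    by (rule special_type_II_local_graph[OF \<Sigma> p])
  let ?M = "planar_motion c s 0 0"
  have M: "rigid_motion ?M" by (rule rigid_motion_planar_motion[OF cs])
  show thesis
  proof (cases "symmetric_type_II U")
    case False
    then show thesis using that[OF cs U g gr] by blast
  next
    case True
    obtain k where k: "\<And>w. w \<in> U \<Longrightarrow> deriv g (fst (snd (?M w))) = k"
      using symmetric_type_II_imp_deriv_constant[OF True U(3) M g gr] by fastforce
    \<comment> \<open>Connectedness makes this range an interval, so that a single constant d serves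
      all of it.\<close>
    let ?I = "(\<lambda>w. fst (snd (?M w))) ` U"
    have "continuous_on U (\<lambda>w. fst (snd (?M w)))"
      unfolding planar_motion_def by (intro continuous_intros)
    then have conv: "convex ?I"
      using connected_continuous_image U(3) is_interval_connected_1 is_interval_convex_1 by metis
    have der: "((\<lambda>y. g y - k * y) has_field_derivative 0) (at y within ?I)" if "y \<in> ?I" for y
    proof -
      have "deriv g y = k" using that k by blast
      then have "(g has_field_derivative k) (at y)" using smooth_on_DERIV[OF g, of y] by simp
      then have "((\<lambda>y. g y - k * y) has_field_derivative k - k * 1) (at y)"
        by (intro DERIV_diff DERIV_cmult DERIV_ident)
      then have "((\<lambda>y. g y - k * y) has_field_derivative 0) (at y)" by simp
      then show ?thesis by (rule has_field_derivative_at_within)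
    qed
    from has_field_derivative_zero_constant[OF conv der]
    obtain d where d: "\<forall>y\<in>?I. g y - k * y = d" ..
    let ?g = "\<lambda>y. k * y + d"
    have "?M ` U \<subseteq> graph (\<lambda>x y. x * y + ?g y)"
    proof
      fix w assume w: "w \<in> ?M ` U"
      then have "fst (snd w) \<in> ?I" by auto
      with d have "g (fst (snd w)) - k * fst (snd w) = d" by (rule bspec)
      then have "g (fst (snd w)) = ?g (fst (snd w))" by simp
      moreover have "w \<in> graph (\<lambda>x y. x * y + g y)" using gr w by blast
      ultimately show "w \<in> graph (\<lambda>x y. x * y + ?g y)" by (simp add: graph_iff)
    qed
    moreover have "smooth_on UNIV ?g" by (intro smooth_on_intros open_UNIV)
    ultimately show thesis using that[OF cs U, of ?g] by blast
  qed
qed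

theorem theorem7p8:
  fixes \<Sigma> :: "heis set"
  assumes "special_type_II \<Sigma>"
  shows
    "(\<forall>p\<in>\<Sigma>. \<exists>U \<phi> g.
        openin (top_of_set \<Sigma>) U \<and> p \<in> U \<and> rigid_motion \<phi> \<and> smooth_on (UNIV :: real set) g \<and>
        \<phi> ` U \<subseteq> graph (\<lambda>x y. x * y + g y) \<and>
        (symmetric_type_II U \<longleftrightarrow> (\<exists>c. \<forall>y. deriv g y = c)))
     \<and>
     (\<forall>U \<phi> g.
        openin (top_of_set \<Sigma>) U \<and> connected U \<and> rigid_motion \<phi> \<and> smooth_on (UNIV :: real set) g \<and>
        \<phi> ` U \<subseteq> graph (\<lambda>x y. x * y + g y) \<longrightarrow>
        (symmetric_type_II U \<longleftrightarrow> (\<exists>c. \<forall>(x, y, z)\<in>\<phi> ` U. deriv g y = c)))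
     \<and>
     (symmetric_type_II \<Sigma> \<longrightarrow>
        (\<forall>p\<in>\<Sigma>. \<exists>U \<phi>.
           openin (top_of_set \<Sigma>) U \<and> p \<in> U \<and> rigid_motion \<phi> \<and>
           \<phi> ` U \<subseteq> graph (\<lambda>x y. x * y)))"
proof (intro conjI ballI allI impI)
  fix U \<phi> g
  assume "openin (top_of_set \<Sigma>) U \<and> connected U \<and> rigid_motion \<phi> \<and> smooth_on (UNIV :: real set) g \<and>
    \<phi> ` U \<subseteq> graph (\<lambda>x y. x * y + g y)"
  then show "symmetric_type_II U \<longleftrightarrow> (\<exists>c. \<forall>(x, y, z)\<in>\<phi> ` U. deriv g y = c)"
    by (elim conjE, intro symmetric_type_II_iff_deriv_constant special_type_II_open_subset[OF assms])
next
  fix p assume p: "p \<in> \<Sigma>"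
  obtain c s U g where cs: "c\<^sup>2 + s\<^sup>2 = 1" and U: "openin (top_of_set \<Sigma>) U" "p \<in> U" "connected U"
    and g: "smooth_on UNIV g" and gr: "planar_motion c s 0 0 ` U \<subseteq> graph (\<lambda>x y. x * y + g y)"
    and lin: "symmetric_type_II U \<longrightarrow> (\<exists>k d. g = (\<lambda>y. k * y + d))"
    by (rule special_type_II_local_graph_adapted[OF assms p])
  let ?M = "planar_motion c s 0 0"
  have M: "rigid_motion ?M" by (rule rigid_motion_planar_motion[OF cs])
  have "symmetric_type_II U \<longleftrightarrow> (\<exists>c. \<forall>y. deriv g y = c)"
  proof
    assume "symmetric_type_II U"
    then obtain k d where kd: "g = (\<lambda>y. k * y + d)" using lin by blast
    have "(g has_field_derivative k) (at y)" for y
      unfolding kd by (auto intro!: derivative_eq_intros)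
    then show "\<exists>c. \<forall>y. deriv g y = c" using DERIV_imp_deriv by blast
  next
    assume "\<exists>c. \<forall>y. deriv g y = c"
    then show "symmetric_type_II U"
      using symmetric_type_II_iff_deriv_constant[OF special_type_II_open_subset[OF assms U(1)] U(3) M g gr]
      by fastforce
  qed
  with U M g gr show "\<exists>U \<phi> g. openin (top_of_set \<Sigma>) U \<and> p \<in> U \<and> rigid_motion \<phi> \<and>
      smooth_on (UNIV :: real set) g \<and> \<phi> ` U \<subseteq> graph (\<lambda>x y. x * y + g y) \<and>
      (symmetric_type_II U \<longleftrightarrow> (\<exists>c. \<forall>y. deriv g y = c))"
    by (intro exI[of _ U] exI[of _ ?M] exI[of _ g] conjI)
next
  fix p assume sym: "symmetric_type_II \<Sigma>" and p: "p \<in> \<Sigma>"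
  obtain c s U g where cs: "c\<^sup>2 + s\<^sup>2 = 1" and U: "openin (top_of_set \<Sigma>) U" "p \<in> U"
    and "connected U" "smooth_on UNIV g"
    and gr: "planar_motion c s 0 0 ` U \<subseteq> graph (\<lambda>x y. x * y + g y)"
    and lin: "symmetric_type_II U \<longrightarrow> (\<exists>k d. g = (\<lambda>y. k * y + d))"
    by (rule special_type_II_local_graph_adapted[OF assms p])
  obtain k d where kd: "g = (\<lambda>y. k * y + d)"
    using lin symmetric_type_II_open_subset[OF sym U(1)] by blast
  \<comment> \<open>Translation by a adds a y to the product x y and subtracts a y from the height;
    each contributes half of the linear term k y, hence a = k / 2.\<close>
  let ?M = "planar_motion c s (k / 2) (- d)"
  have "?M ` U \<subseteq> graph (\<lambda>x y. x * y)"
  proof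
    fix w assume "w \<in> ?M ` U"
    then obtain w' where w': "w' \<in> U" "w = ?M w'" by blast
    then have "planar_motion c s 0 0 w' \<in> graph (\<lambda>x y. x * y + g y)" using gr by blast
    then have "snd (snd w') = (c * fst w' + s * fst (snd w')) * (c * fst (snd w') - s * fst w')
        + k * (c * fst (snd w') - s * fst w') + d"
      by (simp add: graph_iff planar_motion_def kd algebra_simps)
    then show "w \<in> graph (\<lambda>x y. x * y)"
      unfolding w'(2) by (simp add: graph_iff planar_motion_def algebra_simps)
  qed
  with U rigid_motion_planar_motion[OF cs] show "\<exists>U \<phi>. openin (top_of_set \<Sigma>) U \<and> p \<in> U \<and> rigid_motion \<phi> \<and>
      \<phi> ` U \<subseteq> graph (\<lambda>x y. x * y)" by blast
qed

end
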